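(* No two non-isomorphic squids have the same chromatic symmetric function.
   Context: All graphs are finite and simple. A unicyclic graph is a graph containing exactly one cycle. A squid is a connected unicyclic graph having exactly one vertex of degree greater than 2. For a graph $G$, the chromatic symmetric function is ${\mathbf X}_G=\sum_\kappa\prod_{v\in V(G)}x_{\kappa(v)}$, summed over all proper colorings $\kappa:V(G)\to\{1,2,\dots\}$ (adjacent vertices receive distinct colors), in commuting indeterminates $x_1,x_2,\dots$. *)

theory Defs
  imports
    "Graph_Theory.Pair_Digraph"
    "Graph_Theory.Digraph_Component"
    "Graph_Theory.Digraph_Isomorphism"
    "HOL-Library.Poly_Mapping"
    "HOL-Library.FuncSet"
begin

text \<open>
  A finite simple graph is a \<^const>\<open>pair_graph\<close>: an undirected edge between \<open>u\<close> and \<open>v\<close> is the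
  pair of arcs \<open>(u, v)\<close>, \<open>(v, u)\<close>. Hence the degree of a vertex is its out-degree.
\<close>

text \<open>
  In a symmetric digraph the closed walk \<open>u, v, u\<close> is a \<^const>\<open>pre_digraph.cycle\<close>, hence the bound
  on the length. A cycle of a graph is a subgraph, so it is represented by its set of undirected
  edges; this identifies the closed walks that differ in starting point or direction only.
\<close>

definition ugraph_cycles :: "'a pair_pre_digraph \<Rightarrow> 'a set set set" where
  "ugraph_cycles G =
     {(\<lambda>(u, v). {u, v}) ` set p | p. pre_digraph.cycle (with_proj G) p \<and> 3 \<le> length p}"

definition unicyclic :: "'a pair_pre_digraph \<Rightarrow> bool" where
  "unicyclic G \<longleftrightarrow> pair_graph G \<and> (\<exists>!C. C \<in> ugraph_cycles G)"

definition squid :: "'a pair_pre_digraph \<Rightarrow> bool" where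
  "squid G \<longleftrightarrow> unicyclic G \<and> Digraph_Component.connected (with_proj G) \<and>
     (\<exists>!v. v \<in> pverts G \<and> out_degree (with_proj G) v > 2)"

text \<open>Colorings are extensional, so that each map on the vertex set is counted once.\<close>

definition proper_colorings :: "'a pair_pre_digraph \<Rightarrow> ('a \<Rightarrow> nat) set" where
  "proper_colorings G =
     {\<kappa> \<in> pverts G \<rightarrow>\<^sub>E {1..}. \<forall>(u, v) \<in> parcs G. \<kappa> u \<noteq> \<kappa> v}"

text \<open>The exponent vector of the monomial \<open>\<Prod>v. x\<^bsub>\<kappa> v\<^esub>\<close>.\<close>

definition coloring_monomial :: "'a pair_pre_digraph \<Rightarrow> ('a \<Rightarrow> nat) \<Rightarrow> (nat \<Rightarrow>\<^sub>0 nat)" where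
  "coloring_monomial G \<kappa> = (\<Sum>v\<in>pverts G. Poly_Mapping.single (\<kappa> v) 1)"

text \<open>
  A formal power series in the commuting indeterminates \<open>x\<^sub>1, x\<^sub>2, \<dots>\<close> is given by its coefficient
  function on exponent vectors. The coefficient of \<open>m\<close> in the sum of all coloring monomials is the
  number of proper colorings with monomial \<open>m\<close>; it is finite by the lemma below.
\<close>

definition chromatic_symmetric_function :: "'a pair_pre_digraph \<Rightarrow> (nat \<Rightarrow>\<^sub>0 nat) \<Rightarrow> int" where
  "chromatic_symmetric_function G m =
     int (card {\<kappa> \<in> proper_colorings G. coloring_monomial G \<kappa> = m})"

lemma finite_proper_colorings_monomial:
  assumes "pair_graph G"
  shows "finite {\<kappa> \<in> proper_colorings G. coloring_monomial G \<kappa> = m}"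
proof -
  have fin: "finite (pverts G)"
    using assms by (simp add: pair_graph_def pair_digraph_def pair_fin_digraph_def
        pair_fin_digraph_axioms_def)
  have "\<kappa> v \<in> Poly_Mapping.keys (coloring_monomial G \<kappa>)" if v: "v \<in> pverts G" for \<kappa> v
  proof -
    have "Poly_Mapping.lookup (coloring_monomial G \<kappa>) (\<kappa> v)
        = (\<Sum>w\<in>pverts G. Poly_Mapping.lookup (Poly_Mapping.single (\<kappa> w) 1) (\<kappa> v))"
      by (simp add: coloring_monomial_def lookup_sum)
    also have "\<dots> \<ge> Poly_Mapping.lookup (Poly_Mapping.single (\<kappa> v) (1::nat)) (\<kappa> v)"
      using fin v by (intro member_le_sum) auto
    finally show ?thesis
      by (simp add: in_keys_iff)
  qed
  then have "{\<kappa> \<in> proper_colorings G. coloring_monomial G \<kappa> = m}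
      \<subseteq> pverts G \<rightarrow>\<^sub>E Poly_Mapping.keys m"
    by (auto simp: proper_colorings_def PiE_iff extensional_def)
  then show ?thesis
    by (rule finite_subset) (use fin in \<open>auto intro: finite_PiE\<close>)
qed

lemma digraph_iso_with_proj_iff:
  assumes G: "pair_wf_digraph G" and H: "pair_wf_digraph H"
  shows "digraph_iso (with_proj G) (with_proj H) \<longleftrightarrow>
    (\<exists>f. bij_betw f (pverts G) (pverts H) \<and>
      (\<forall>u\<in>pverts G. \<forall>v\<in>pverts G. (u, v) \<in> parcs G \<longleftrightarrow> (f u, f v) \<in> parcs H))"
    (is "?L \<longleftrightarrow> (\<exists>f. ?P f)")
proof
  assume ?L
  then obtain h where h: "pre_digraph.digraph_isomorphism (with_proj G) h"
      and eq: "with_proj H = app_iso h (with_proj G)"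
    by (auto simp: digraph_iso_def)
  let ?f = "iso_verts h"
  from eq have V: "pverts H = ?f ` pverts G" and A: "parcs H = iso_arcs h ` parcs G"
      and T: "iso_tail h = fst" and D: "iso_head h = snd"
    by (auto simp: with_proj_def app_iso_def)
  have inj: "inj_on ?f (pverts G)"
      and arc: "\<And>u v. (u, v) \<in> parcs G \<Longrightarrow> iso_arcs h (u, v) = (?f u, ?f v)"
    using h T D by (auto simp: pre_digraph.digraph_isomorphism_def prod_eq_iff)
  have "(u, v) \<in> parcs G \<longleftrightarrow> (?f u, ?f v) \<in> parcs H"
    if u: "u \<in> pverts G" and v: "v \<in> pverts G" for u v
  proof
    assume "(u, v) \<in> parcs G"
    then show "(?f u, ?f v) \<in> parcs H"
      using arc A by (metis imageI)
  next
    assume "(?f u, ?f v) \<in> parcs H"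
    then obtain x y where xy: "(x, y) \<in> parcs G" "(?f u, ?f v) = iso_arcs h (x, y)"
      using A by auto
    moreover have "x \<in> pverts G" "y \<in> pverts G"
      using xy(1) G pair_wf_digraph.in_arcsD1 pair_wf_digraph.in_arcsD2 by metis+
    ultimately show "(u, v) \<in> parcs G"
      using arc inj u v by (auto simp: inj_on_eq_iff)
  qed
  with inj V show "\<exists>f. ?P f"
    by (intro exI[of _ ?f]) (auto simp: bij_betw_def)
next
  assume "\<exists>f. ?P f"
  then obtain f where f: "?P f" ..
  define h where "h = \<lparr>iso_verts = f, iso_arcs = map_prod f f, iso_head = snd, iso_tail = fst\<rparr>"
  have GV: "u \<in> pverts G \<and> v \<in> pverts G" if "(u, v) \<in> parcs G" for u v
    using that G pair_wf_digraph.in_arcsD1 pair_wf_digraph.in_arcsD2 by metis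
  have HV: "u \<in> pverts H \<and> v \<in> pverts H" if "(u, v) \<in> parcs H" for u v
    using that H pair_wf_digraph.in_arcsD1 pair_wf_digraph.in_arcsD2 by metis
  have img: "f ` pverts G = pverts H" and inj: "inj_on f (pverts G)"
    using f by (auto simp: bij_betw_def)
  have "parcs H = map_prod f f ` parcs G"
  proof (intro equalityI subrelI)
    fix x y assume xy: "(x, y) \<in> parcs H"
    with HV img obtain u v where uv: "u \<in> pverts G" "v \<in> pverts G" "x = f u" "y = f v"
      by (metis imageE)
    with f xy have "(u, v) \<in> parcs G"
      by simp
    with uv show "(x, y) \<in> map_prod f f ` parcs G"
      by force
  next
    fix x y assume "(x, y) \<in> map_prod f f ` parcs G"
    then obtain u v where "(u, v) \<in> parcs G" "x = f u" "y = f v"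
      by auto
    with f GV show "(x, y) \<in> parcs H"
      by blast
  qed
  then have eq: "with_proj H = app_iso h (with_proj G)"
    using img by (simp add: with_proj_def app_iso_def h_def)
  have "wf_digraph (with_proj G)"
    using GV by unfold_locales auto
  moreover have "inj_on (map_prod f f) (parcs G)"
    using GV inj by (fastforce simp: inj_on_def)
  ultimately have "pre_digraph.digraph_isomorphism (with_proj G) h"
    using inj by (simp add: pre_digraph.digraph_isomorphism_def h_def)
  with eq show ?L
    unfolding digraph_iso_def by blast
qed

end

theory Submission
  imports Defs "HOL-Computational_Algebra.Polynomial"
begin

text \<open>
  Count the proper colorings with \<open>q + r\<close> colors in which exactly \<open>j\<close> vertices get one of the last
  \<open>r\<close> colors; this number is determined by the chromatic symmetric function. It is the sum, over the
  \<open>j\<close>-subsets \<open>A\<close> of the vertices, of the chromatic polynomial of \<open>A\<close> at \<open>r\<close> times that of the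
  complement at \<open>q\<close>. The linear coefficient of a chromatic polynomial vanishes for a disconnected
  graph and is, up to a sign depending on the number of vertices only, 1 for a tree and \<open>m - 1\<close> for a
  connected unicyclic graph with cycle length \<open>m\<close>. So the coefficient of \<open>q r\<close> is a weighted count of
  the splittings into two connected parts.

  For a squid, the linear coefficient of the whole graph gives \<open>m\<close>. The part of a connected splitting
  that avoids the hub is either the end of a tentacle (weight \<open>m - 1\<close>) or a segment of the cycle
  (weight 1). Hence \<open>t j + t (n - j)\<close> is determined, where \<open>t j\<close> is the number of tentacles of length
  at least \<open>j\<close> and \<open>n\<close> is the number of vertices. Since at most one tentacle is longer than \<open>n / 2\<close>,
  these sums determine \<open>t\<close>, and thereby the tentacle lengths.
\<close>

section \<open>Chromatic polynomials\<close>

text \<open>The symmetric function is used only through the color class sizes that its monomials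
  record, so everything reduces to counting colorings and to polynomial identities in one variable.

  The obstacle is that a splitting is unordered: a part of size \<open>j\<close> comes with a part
  of size \<open>n - j\<close>, and only the sum of the two counts is visible. Each splitting is
  therefore listed by its part without the hub, whose possible shapes are few. A piece from the
  middle of a tentacle contributes nothing, since its removal cuts off the end of the tentacle. The
  ambiguity between \<open>j\<close> and \<open>n - j\<close> is resolved by slack: the tentacle
  lengths add up to \<open>n - m\<close>, which is at most \<open>n - 3\<close>, so next to a
  tentacle of length \<open>L\<close> every other one is shorter than \<open>n - L - 1\<close>.

  The counting is done on a model with explicit coordinates. That every squid has such coordinates
  is a separate argument, and only there do the uniqueness of the cycle and the degree condition
  enter.\<close>

definition induced_colorings :: "'a rel \<Rightarrow> 'a set \<Rightarrow> nat set \<Rightarrow> ('a \<Rightarrow> nat) set" where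
  "induced_colorings R A C =
     {\<kappa> \<in> A \<rightarrow>\<^sub>E C. \<forall>u\<in>A. \<forall>w\<in>A. (u, w) \<in> R \<longrightarrow> \<kappa> u \<noteq> \<kappa> w}"

lemma finite_induced_colorings:
  assumes "finite A" "finite C"
  shows "finite (induced_colorings R A C)"
  using finite_PiE[of A "\<lambda>_. C"] assms by (simp add: induced_colorings_def)

text \<open>Renaming colors along a bijection keeps the number of colors used. The predicate
  \<open>P\<close> on that number serves two purposes: counting all colorings, and counting those
  that use every color of the palette.\<close>

lemma card_induced_colorings_le:
  assumes "finite A" "finite C'" "card C = card C'" "finite C"
  shows "card {\<kappa> \<in> induced_colorings R A C. P (card (\<kappa> ` A))} \<le>
    card {\<kappa> \<in> induced_colorings R A C'. P (card (\<kappa> ` A))}" (is "card ?S \<le> card ?S'")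
proof -
  obtain h where h: "bij_betw h C C'"
    using assms finite_same_card_bij by blast
  have inj: "inj_on h C" and img: "h ` C = C'"
    using h by (auto simp: bij_betw_def)
  show ?thesis
  proof (rule card_inj_on_le)
    show "finite ?S'"
      using assms by (simp add: finite_induced_colorings)
    show "inj_on (\<lambda>\<kappa>. restrict (h \<circ> \<kappa>) A) ?S"
    proof (rule inj_onI)
      fix \<kappa> \<mu>
      assume \<kappa>: "\<kappa> \<in> ?S" and \<mu>: "\<mu> \<in> ?S"
        and eq: "restrict (h \<circ> \<kappa>) A = restrict (h \<circ> \<mu>) A"
      show "\<kappa> = \<mu>"
      proof (rule PiE_ext)
        show "\<kappa> \<in> A \<rightarrow>\<^sub>E C" "\<mu> \<in> A \<rightarrow>\<^sub>E C"
          using \<kappa> \<mu> by (auto simp: induced_colorings_def)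
        fix x assume "x \<in> A"
        then have "h (\<kappa> x) = h (\<mu> x)" "\<kappa> x \<in> C" "\<mu> x \<in> C"
          using fun_cong[OF eq, of x] \<kappa> \<mu> by (auto simp: induced_colorings_def)
        then show "\<kappa> x = \<mu> x"
          using inj by (auto simp: inj_on_def)
      qed
    qed
    show "(\<lambda>\<kappa>. restrict (h \<circ> \<kappa>) A) ` ?S \<subseteq> ?S'"
    proof (intro image_subsetI)
      fix \<kappa> assume \<kappa>: "\<kappa> \<in> ?S"
      then have val: "\<kappa> x \<in> C" if "x \<in> A" for x
        using that by (auto simp: induced_colorings_def)
      have "h (\<kappa> u) \<noteq> h (\<kappa> w)" if "u \<in> A" "w \<in> A" "(u, w) \<in> R" for u w
        using that \<kappa> val inj by (auto simp: induced_colorings_def inj_on_eq_iff)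
      then have "restrict (h \<circ> \<kappa>) A \<in> induced_colorings R A C'"
        using val img by (auto simp: induced_colorings_def)
      moreover have "card (restrict (h \<circ> \<kappa>) A ` A) = card (\<kappa> ` A)"
        using card_image[OF inj_on_subset[OF inj, of "\<kappa> ` A"]] val
        by (simp add: image_image image_subset_iff)
      ultimately show "restrict (h \<circ> \<kappa>) A \<in> ?S'"
        using \<kappa> by simp
    qed
  qed
qed

lemma card_induced_colorings_cong:
  assumes "finite A" "finite C" "finite C'" "card C = card C'"
  shows "card {\<kappa> \<in> induced_colorings R A C. P (card (\<kappa> ` A))} =
    card {\<kappa> \<in> induced_colorings R A C'. P (card (\<kappa> ` A))}"
  using card_induced_colorings_le[OF assms(1,3,4,2)]
    card_induced_colorings_le[OF assms(1,2) assms(4)[symmetric] assms(3)] by (intro antisym)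

lemma card_induced_colorings_eq:
  assumes "finite A" "finite C" "card C = q"
  shows "card (induced_colorings R A C) = card (induced_colorings R A {1..q})"
  using card_induced_colorings_cong[of A C "{1..q}" R "\<lambda>_. True"] assms by simp

text \<open>Extensionality makes a map on \<open>A \<union> B\<close> the same thing as the pair of
  its restrictions.\<close>

lemma card_glue:
  assumes "A \<inter> B = {}" "X \<subseteq> extensional A" "Y \<subseteq> extensional B"
  shows "card {\<kappa> \<in> extensional (A \<union> B). restrict \<kappa> A \<in> X \<and> restrict \<kappa> B \<in> Y} = card X * card Y"
proof -
  have "bij_betw (\<lambda>\<kappa>. (restrict \<kappa> A, restrict \<kappa> B))
      {\<kappa> \<in> extensional (A \<union> B). restrict \<kappa> A \<in> X \<and> restrict \<kappa> B \<in> Y} (X \<times> Y)"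
  proof (rule bij_betw_byWitness[where f' = "\<lambda>(f, g). restrict (\<lambda>x. if x \<in> A then f x else g x) (A \<union> B)"])
    have *: "restrict (restrict (\<lambda>x. if x \<in> A then f x else g x) (A \<union> B)) A = f"
      "restrict (restrict (\<lambda>x. if x \<in> A then f x else g x) (A \<union> B)) B = g"
      if "f \<in> X" "g \<in> Y" for f g
      using that assms by (fastforce simp: fun_eq_iff extensional_def restrict_def)+
    show "\<forall>p\<in>X \<times> Y. (\<lambda>\<kappa>. (restrict \<kappa> A, restrict \<kappa> B))
        ((\<lambda>(f, g). restrict (\<lambda>x. if x \<in> A then f x else g x) (A \<union> B)) p) = p"
      using * by auto
    show "(\<lambda>(f, g). restrict (\<lambda>x. if x \<in> A then f x else g x) (A \<union> B)) ` (X \<times> Y)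
        \<subseteq> {\<kappa> \<in> extensional (A \<union> B). restrict \<kappa> A \<in> X \<and> restrict \<kappa> B \<in> Y}"
      using * by auto
  qed (auto simp: fun_eq_iff extensional_def restrict_def)
  then show ?thesis
    by (simp add: bij_betw_same_card card_cartesian_product)
qed

lemma card_induced_colorings_disjoint_union:
  assumes "A \<inter> B = {}" "\<forall>u\<in>A. \<forall>w\<in>B. (u, w) \<notin> R \<and> (w, u) \<notin> R"
  shows "card (induced_colorings R (A \<union> B) C) =
    card (induced_colorings R A C) * card (induced_colorings R B C)"
proof -
  have "induced_colorings R (A \<union> B) C =
      {\<kappa> \<in> extensional (A \<union> B). restrict \<kappa> A \<in> induced_colorings R A C \<and>
        restrict \<kappa> B \<in> induced_colorings R B C}"
    using assms by (auto simp: induced_colorings_def PiE_def Pi_def)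
  also have "card \<dots> = card (induced_colorings R A C) * card (induced_colorings R B C)"
    using assms by (intro card_glue) (auto simp: induced_colorings_def PiE_def)
  finally show ?thesis .
qed

text \<open>Disjoint palettes satisfy every edge between \<open>A\<close> and \<open>V - A\<close>
  automatically, so the two sides are colored independently. This is what turns a count of colorings
  into a sum over splittings.\<close>

lemma card_induced_colorings_split:
  assumes sub: "A \<subseteq> V" and disj: "C \<inter> D = {}"
  shows "card {\<kappa> \<in> induced_colorings R V (C \<union> D). {x \<in> V. \<kappa> x \<in> D} = A} =
    card (induced_colorings R A D) * card (induced_colorings R (V - A) C)"
proof -
  have "{\<kappa> \<in> induced_colorings R V (C \<union> D). {x \<in> V. \<kappa> x \<in> D} = A} =
      {\<kappa> \<in> extensional (A \<union> (V - A)). restrict \<kappa> A \<in> induced_colorings R A D \<and>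
        restrict \<kappa> (V - A) \<in> induced_colorings R (V - A) C}" (is "?L = ?R")
  proof (intro equalityI subsetI)
    fix \<kappa> assume "\<kappa> \<in> ?L"
    then show "\<kappa> \<in> ?R"
      using sub by (auto simp: induced_colorings_def PiE_def Pi_def extensional_def)
  next
    fix \<kappa> assume r: "\<kappa> \<in> ?R"
    have V: "A \<union> (V - A) = V"
      using sub by auto
    have a: "\<kappa> x \<in> D" if "x \<in> A" for x
      using r that by (auto simp: induced_colorings_def PiE_def Pi_def)
    have b: "\<kappa> x \<in> C" if "x \<in> V" "x \<notin> A" for x
      using r that by (auto simp: induced_colorings_def PiE_def Pi_def)
    have "\<kappa> u \<noteq> \<kappa> w" if "u \<in> V" "w \<in> V" "(u, w) \<in> R" for u w
    proof (cases "u \<in> A"; cases "w \<in> A")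
      assume "u \<in> A" "w \<in> A"
      then show ?thesis using r that(3) by (simp add: induced_colorings_def)
    next
      assume "u \<notin> A" "w \<notin> A"
      then show ?thesis using r that by (simp add: induced_colorings_def)
    next
      assume "u \<in> A" "w \<notin> A"
      then have "\<kappa> u \<in> D" "\<kappa> w \<in> C" using a b that by auto
      then show ?thesis using disj by (metis disjoint_iff)
    next
      assume "u \<notin> A" "w \<in> A"
      then have "\<kappa> u \<in> C" "\<kappa> w \<in> D" using a b that by auto
      then show ?thesis using disj by (metis disjoint_iff)
    qed
    moreover have "{x \<in> V. \<kappa> x \<in> D} = A"
      using a b disj sub by blast
    moreover have "\<kappa> \<in> V \<rightarrow>\<^sub>E (C \<union> D)"
      using r a b V by (auto simp: PiE_def)
    ultimately show "\<kappa> \<in> ?L"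
      by (auto simp: induced_colorings_def)
  qed
  also have "card \<dots> = card (induced_colorings R A D) * card (induced_colorings R (V - A) C)"
    by (intro card_glue) (auto simp: induced_colorings_def PiE_def)
  finally show ?thesis .
qed

lemma card_induced_colorings_insert_leaf:
  assumes w: "w \<notin> A" and u: "u \<in> A" and fin: "finite A" "finite C"
    and sym: "sym R" and nb: "\<And>x. x \<in> A \<Longrightarrow> (w, x) \<in> R \<longleftrightarrow> x = u" and irr: "(w, w) \<notin> R"
  shows "card (induced_colorings R (insert w A) C) = (card C - 1) * card (induced_colorings R A C)"
proof -
  have nb': "\<And>x. x \<in> A \<Longrightarrow> (x, w) \<in> R \<longleftrightarrow> x = u"
    using sym nb by (metis symD)
  have "bij_betw (\<lambda>\<kappa>. (restrict \<kappa> A, \<kappa> w)) (induced_colorings R (insert w A) C)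
      (SIGMA \<kappa>:induced_colorings R A C. C - {\<kappa> u})"
  proof (rule bij_betw_byWitness[where f' = "\<lambda>(\<kappa>, c). \<kappa>(w := c)"])
    show "\<forall>\<kappa>\<in>induced_colorings R (insert w A) C. (\<lambda>(\<kappa>, c). \<kappa>(w := c)) (restrict \<kappa> A, \<kappa> w) = \<kappa>"
      by (auto simp: induced_colorings_def PiE_def extensional_def fun_eq_iff restrict_def)
    show "\<forall>p\<in>(SIGMA \<kappa>:induced_colorings R A C. C - {\<kappa> u}).
        (\<lambda>\<kappa>. (restrict \<kappa> A, \<kappa> w)) ((\<lambda>(\<kappa>, c). \<kappa>(w := c)) p) = p"
      using w by (auto simp: induced_colorings_def PiE_def extensional_def fun_eq_iff restrict_def)
    show "(\<lambda>\<kappa>. (restrict \<kappa> A, \<kappa> w)) ` induced_colorings R (insert w A) C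
        \<subseteq> (SIGMA \<kappa>:induced_colorings R A C. C - {\<kappa> u})"
      using u nb by (auto simp: induced_colorings_def PiE_def Pi_def)
    show "(\<lambda>(\<kappa>, c). \<kappa>(w := c)) ` (SIGMA \<kappa>:induced_colorings R A C. C - {\<kappa> u})
        \<subseteq> induced_colorings R (insert w A) C"
      using u w nb nb' irr
      by (auto simp: induced_colorings_def PiE_def Pi_def extensional_def split: if_splits)
  qed
  then have "card (induced_colorings R (insert w A) C) =
      card (SIGMA \<kappa>:induced_colorings R A C. C - {\<kappa> u})"
    by (rule bij_betw_same_card)
  also have "\<dots> = (\<Sum>\<kappa>\<in>induced_colorings R A C. card (C - {\<kappa> u}))"
    using fin by (intro card_SigmaI) (auto intro: finite_induced_colorings)
  also have "\<dots> = (\<Sum>\<kappa>\<in>induced_colorings R A C. card C - 1)"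
    using u fin by (intro sum.cong) (auto simp: induced_colorings_def PiE_def Pi_def)
  finally show ?thesis
    by (simp add: mult.commute)
qed

section \<open>Polynomials through their values at natural numbers\<close>

lemma poly_eqI_of_nat:
  fixes p p' :: "'a::{idom, semiring_char_0} poly"
  assumes "\<And>q::nat. poly p (of_nat q) = poly p' (of_nat q)"
  shows "p = p'"
proof (rule ccontr)
  assume "p \<noteq> p'"
  then have "finite {x. poly (p - p') x = 0}"
    by (intro poly_roots_finite) simp
  moreover have "range of_nat \<subseteq> {x. poly (p - p') x = 0}"
    using assms by auto
  ultimately have "finite (range (of_nat :: nat \<Rightarrow> 'a))"
    by (rule rev_finite_subset)
  then show False
    using finite_imageD[OF _ inj_of_nat] by auto
qed

definition binomial_poly :: "nat \<Rightarrow> rat poly" where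
  "binomial_poly k = smult (1 / fact k) (\<Prod>i<k. [:- of_nat i, 1:])"

lemma poly_binomial_poly: "poly (binomial_poly k) (of_nat q) = of_nat (q choose k)"
  by (simp add: binomial_poly_def poly_prod binomial_gbinomial gbinomial_prod_rev
      atLeast0LessThan)

text \<open>Sorting colorings by the set of colors used shows that their number is a combination of
  binomial coefficients in the number of available colors.\<close>

lemma ex_chromatic_poly:
  assumes fin: "finite A"
  shows "\<exists>p :: rat poly. \<forall>q. poly p (of_nat q) = of_nat (card (induced_colorings R A {1..q}))"
proof -
  define s where "s D = card {\<kappa> \<in> induced_colorings R A D. \<kappa> ` A = D}" for D :: "nat set"
  define p where "p = (\<Sum>k\<le>card A. smult (of_nat (s {1..k})) (binomial_poly k))"
  have eq_iff: "\<kappa> ` A = D \<longleftrightarrow> card (\<kappa> ` A) = card D"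
    if "\<kappa> \<in> induced_colorings R A D" "finite D" for \<kappa> and D :: "nat set"
    using that card_subset_eq[of D "\<kappa> ` A"] by (auto simp: induced_colorings_def)
  have s: "s D = s {1..card D}" if D: "finite D" for D
  proof -
    have "s D = card {\<kappa> \<in> induced_colorings R A D. card (\<kappa> ` A) = card D}"
      unfolding s_def using D eq_iff by (intro arg_cong[where f = card]) auto
    also have "\<dots> = card {\<kappa> \<in> induced_colorings R A {1..card D}. card (\<kappa> ` A) = card D}"
      using card_induced_colorings_cong[of A D "{1..card D}" R "\<lambda>c. c = card D"] D fin by simp
    also have "\<dots> = s {1..card D}"
      unfolding s_def using eq_iff[of _ "{1..card D}"] by (intro arg_cong[where f = card]) auto
    finally show ?thesis .
  qed
  have s0: "s {1..k} = 0" if "card A < k" for k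
  proof -
    have "\<kappa> ` A \<noteq> {1..k}" for \<kappa>
      using card_image_le[OF fin, of \<kappa>] that by auto
    then show ?thesis
      by (simp add: s_def)
  qed
  have "of_nat (card (induced_colorings R A {1..q})) = poly p (of_nat q)" for q
  proof -
    have "induced_colorings R A {1..q} =
        (\<Union>D\<in>Pow {1..q}. {\<kappa> \<in> induced_colorings R A D. \<kappa> ` A = D})"
      by (auto simp: induced_colorings_def PiE_def Pi_def)
    also have "card \<dots> = (\<Sum>D\<in>Pow {1..q}. s D)"
      unfolding s_def
      by (subst card_UN_disjoint) (auto simp: finite_induced_colorings fin finite_subset)
    also have "\<dots> = (\<Sum>D\<in>Pow {1..q}. s {1..card D})"
      by (intro sum.cong refl s) (auto simp: finite_subset)
    also have "\<dots> = (\<Sum>k\<in>{..q}. \<Sum>D | D \<in> Pow {1..q} \<and> card D = k. s {1..card D})"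
      by (rule sum.group[symmetric]) (auto dest: card_mono[rotated])
    also have "\<dots> = (\<Sum>k\<in>{..q}. (q choose k) * s {1..k})"
      using n_subsets[of "{1..q}"] by (intro sum.cong) auto
    \<comment> \<open>The terms beyond \<open>q\<close> vanish by the binomial coefficient, those
      beyond \<open>card A\<close> because no coloring uses more colors than there are vertices. The
      maximum links the two ranges.\<close>
    also have "\<dots> = (\<Sum>k\<in>{..max q (card A)}. (q choose k) * s {1..k})"
      by (intro sum.mono_neutral_left) auto
    also have "\<dots> = (\<Sum>k\<in>{..card A}. (q choose k) * s {1..k})"
      by (intro sum.mono_neutral_right) (use s0 in auto)
    finally show ?thesis
      by (simp add: p_def poly_sum poly_binomial_poly mult.commute)
  qed
  then show ?thesis by metis
qed

text \<open>For finite \<open>A\<close> the choice is unambiguous: existence is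
  \<open>ex_chromatic_poly\<close>, and uniqueness follows from
  \<open>poly_eqI_of_nat\<close>.\<close>

definition chromatic_poly :: "'a rel \<Rightarrow> 'a set \<Rightarrow> rat poly" where
  "chromatic_poly R A =
     (SOME p. \<forall>q. poly p (of_nat q) = of_nat (card (induced_colorings R A {1..q})))"

lemma poly_chromatic_poly:
  assumes "finite A"
  shows "poly (chromatic_poly R A) (of_nat q) = of_nat (card (induced_colorings R A {1..q}))"
  using someI_ex[OF ex_chromatic_poly[OF assms, of R]] by (simp add: chromatic_poly_def)

lemma chromatic_polyI:
  assumes "finite A" "\<And>q. of_nat (card (induced_colorings R A {1..q})) = poly p (of_nat q)"
  shows "chromatic_poly R A = p"
  using assms by (intro poly_eqI_of_nat) (simp add: poly_chromatic_poly)

section \<open>The linear coefficient\<close>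

lemma induced_colorings_no_color: "A \<noteq> {} \<Longrightarrow> induced_colorings R A {} = {}"
  by (auto simp: induced_colorings_def PiE_def Pi_def)

text \<open>Without colors a nonempty set has no coloring, so 0 is a root. The behavior of linear
  coefficients under products rests on this.\<close>

lemma coeff_0_chromatic_poly:
  assumes "finite A" "A \<noteq> {}"
  shows "coeff (chromatic_poly R A) 0 = 0"
  using poly_chromatic_poly[OF assms(1), of R 0] induced_colorings_no_color[OF assms(2), of R]
  by (simp add: poly_0_coeff_0)

text \<open>The sign is chosen such that attaching a pendant vertex does not change the value.\<close>

definition linear_chromatic :: "'a rel \<Rightarrow> 'a set \<Rightarrow> rat" where
  "linear_chromatic R A = (- 1) ^ Suc (card A) * coeff (chromatic_poly R A) 1"

lemma linear_chromatic_single: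
  assumes "(x, x) \<notin> R"
  shows "linear_chromatic R {x} = 1"
proof -
  have "chromatic_poly R {x} = [:0, 1:]"
  proof (rule chromatic_polyI)
    fix q
    have "induced_colorings R {x} {1..q} = {x} \<rightarrow>\<^sub>E {1..q}"
      using assms by (auto simp: induced_colorings_def)
    then show "of_nat (card (induced_colorings R {x} {1..q})) = poly [:0, 1:] (of_nat q :: rat)"
      by (simp add: card_PiE)
  qed simp
  then show ?thesis
    by (simp add: linear_chromatic_def)
qed

text \<open>The two pieces are colored independently, and a product of two polynomials without
  constant term has no linear term.\<close>

lemma linear_chromatic_disconnected:
  assumes fin: "finite A" "finite B" and ne: "A \<noteq> {}" "B \<noteq> {}" and disj: "A \<inter> B = {}"
    and no: "\<forall>u\<in>A. \<forall>w\<in>B. (u, w) \<notin> R \<and> (w, u) \<notin> R"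
  shows "linear_chromatic R (A \<union> B) = 0"
proof -
  have "chromatic_poly R (A \<union> B) = chromatic_poly R A * chromatic_poly R B"
    using fin card_induced_colorings_disjoint_union[OF disj no]
    by (intro chromatic_polyI) (auto simp: poly_chromatic_poly)
  then show ?thesis
    using coeff_0_chromatic_poly[OF fin(1) ne(1), of R] coeff_0_chromatic_poly[OF fin(2) ne(2), of R]
    by (simp add: linear_chromatic_def coeff_mult)
qed

text \<open>A pendant vertex contributes the factor \<open>X - 1\<close>. As the constant term is 0,
  this negates the linear coefficient, and the sign in \<open>linear_chromatic\<close> undoes the
  negation.\<close>

lemma linear_chromatic_insert_leaf:
  assumes w: "w \<notin> A" and u: "u \<in> A" and fin: "finite A"
    and sym: "sym R" and nb: "\<And>x. x \<in> A \<Longrightarrow> (w, x) \<in> R \<longleftrightarrow> x = u" and irr: "(w, w) \<notin> R"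
  shows "linear_chromatic R (insert w A) = linear_chromatic R A"
proof -
  have ne: "A \<noteq> {}" using u by auto
  have "chromatic_poly R (insert w A) = [:- 1, 1:] * chromatic_poly R A"
  proof (rule chromatic_polyI)
    fix q :: nat
    show "of_nat (card (induced_colorings R (insert w A) {1..q})) =
        poly ([:- 1, 1:] * chromatic_poly R A) (of_nat q)"
    proof (cases q)
      \<comment> \<open>Here the subtraction \<open>card C - 1\<close> is truncated and does not
        agree with the value -1 of the linear factor; both sides are 0 nevertheless.\<close>
      case 0
      then show ?thesis
        using fin poly_chromatic_poly[OF fin, of R 0]
        by (simp add: induced_colorings_no_color ne)
    next
      case (Suc k)
      then show ?thesis
        using card_induced_colorings_insert_leaf[OF w u fin _ sym nb irr, of "{1..q}"] fin
          poly_chromatic_poly[OF fin, of R q]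
        by (simp add: algebra_simps)
    qed
  qed (use fin in simp)
  then show ?thesis
    using coeff_0_chromatic_poly[OF fin ne, of R] w fin
    by (simp add: linear_chromatic_def)
qed

lemma card_induced_colorings_image:
  assumes inj: "inj_on f A"
    and adj: "\<And>u w. u \<in> A \<Longrightarrow> w \<in> A \<Longrightarrow> (f u, f w) \<in> R' \<longleftrightarrow> (u, w) \<in> R"
  shows "card (induced_colorings R' (f ` A) C) = card (induced_colorings R A C)"
proof (rule bij_betw_same_card, rule bij_betw_byWitness[where f' = "\<lambda>\<kappa>. restrict (\<kappa> \<circ> inv_into A f) (f ` A)"])
  show "\<forall>\<kappa>\<in>induced_colorings R' (f ` A) C.
      restrict (restrict (\<kappa> \<circ> f) A \<circ> inv_into A f) (f ` A) = \<kappa>"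
    using inj by (fastforce simp: induced_colorings_def PiE_def extensional_def fun_eq_iff)
  show "\<forall>\<kappa>\<in>induced_colorings R A C. restrict (restrict (\<kappa> \<circ> inv_into A f) (f ` A) \<circ> f) A = \<kappa>"
    using inj by (auto simp: induced_colorings_def PiE_def extensional_def fun_eq_iff restrict_def)
  show "(\<lambda>\<kappa>. restrict (\<kappa> \<circ> f) A) ` induced_colorings R' (f ` A) C \<subseteq> induced_colorings R A C"
    using adj by (auto simp: induced_colorings_def)
  show "(\<lambda>\<kappa>. restrict (\<kappa> \<circ> inv_into A f) (f ` A)) ` induced_colorings R A C
      \<subseteq> induced_colorings R' (f ` A) C"
    using adj inj by (auto simp: induced_colorings_def)
qed

lemma linear_chromatic_image:
  assumes "finite A" "inj_on f A"
    "\<And>u w. u \<in> A \<Longrightarrow> w \<in> A \<Longrightarrow> (f u, f w) \<in> R' \<longleftrightarrow> (u, w) \<in> R"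
  shows "linear_chromatic R' (f ` A) = linear_chromatic R A"
proof -
  have "chromatic_poly R' (f ` A) = chromatic_poly R A"
    using assms by (intro chromatic_polyI) (simp_all add: poly_chromatic_poly card_induced_colorings_image)
  then show ?thesis
    using assms by (simp add: linear_chromatic_def card_image)
qed

section \<open>Paths and cycles\<close>

definition path_colorings :: "nat \<Rightarrow> nat set \<Rightarrow> (nat \<Rightarrow> nat) set" where
  "path_colorings n C = {\<kappa> \<in> {..n} \<rightarrow>\<^sub>E C. \<forall>i<n. \<kappa> i \<noteq> \<kappa> (Suc i)}"

lemma finite_path_colorings: "finite C \<Longrightarrow> finite (path_colorings n C)"
  using finite_PiE[of "{..n}" "\<lambda>_. C"] by (simp add: path_colorings_def)

lemma card_path_colorings:
  assumes "finite C"
  shows "card (path_colorings n C) = card C * (card C - 1) ^ n"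
proof (induction n)
  case 0
  have "path_colorings 0 C = {0} \<rightarrow>\<^sub>E C"
    by (auto simp: path_colorings_def)
  then show ?case
    by (simp add: card_PiE)
next
  case (Suc n)
  have "bij_betw (\<lambda>\<kappa>. (restrict \<kappa> {..n}, \<kappa> (Suc n))) (path_colorings (Suc n) C)
      (SIGMA \<kappa>:path_colorings n C. C - {\<kappa> n})"
  proof (rule bij_betw_byWitness[where f' = "\<lambda>(\<kappa>, c). \<kappa>(Suc n := c)"])
    show "\<forall>\<kappa>\<in>path_colorings (Suc n) C. (\<lambda>(\<kappa>, c). \<kappa>(Suc n := c)) (restrict \<kappa> {..n}, \<kappa> (Suc n)) = \<kappa>"
      by (auto simp: path_colorings_def PiE_def extensional_def fun_eq_iff restrict_def le_Suc_eq)
    show "\<forall>p\<in>(SIGMA \<kappa>:path_colorings n C. C - {\<kappa> n}).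
        (\<lambda>\<kappa>. (restrict \<kappa> {..n}, \<kappa> (Suc n))) ((\<lambda>(\<kappa>, c). \<kappa>(Suc n := c)) p) = p"
      by (auto simp: path_colorings_def PiE_def extensional_def fun_eq_iff restrict_def)
    show "(\<lambda>\<kappa>. (restrict \<kappa> {..n}, \<kappa> (Suc n))) ` path_colorings (Suc n) C
        \<subseteq> (SIGMA \<kappa>:path_colorings n C. C - {\<kappa> n})"
      by (auto simp: path_colorings_def PiE_def Pi_def)
    show "(\<lambda>(\<kappa>, c). \<kappa>(Suc n := c)) ` (SIGMA \<kappa>:path_colorings n C. C - {\<kappa> n})
        \<subseteq> path_colorings (Suc n) C"
      by (auto simp: path_colorings_def PiE_def Pi_def extensional_def le_Suc_eq less_Suc_eq)
  qed
  then have "card (path_colorings (Suc n) C) = card (SIGMA \<kappa>:path_colorings n C. C - {\<kappa> n})"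
    by (rule bij_betw_same_card)
  also have "\<dots> = (\<Sum>\<kappa>\<in>path_colorings n C. card (C - {\<kappa> n}))"
    using assms by (intro card_SigmaI) (auto intro: finite_path_colorings)
  also have "\<dots> = (\<Sum>\<kappa>\<in>path_colorings n C. card C - 1)"
    using assms by (intro sum.cong) (auto simp: path_colorings_def PiE_def Pi_def)
  finally show ?case
    using Suc.IH by simp
qed

text \<open>A coloring of the path \<open>0, \<dots>, n + 1\<close> either has distinct end colors, and colors the cycle on
  the same vertices, or restricts to a coloring of the path \<open>0, \<dots>, n\<close> with distinct end colors.\<close>

lemma card_path_colorings_distinct_ends:
  assumes fin: "finite C"
  shows "card {\<kappa> \<in> path_colorings (Suc n) C. \<kappa> 0 \<noteq> \<kappa> (Suc n)} +
    card {\<kappa> \<in> path_colorings n C. \<kappa> 0 \<noteq> \<kappa> n} = card C * (card C - 1) ^ Suc n"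
proof -
  have "bij_betw (\<lambda>\<kappa>. restrict \<kappa> {..n}) {\<kappa> \<in> path_colorings (Suc n) C. \<kappa> 0 = \<kappa> (Suc n)}
      {\<kappa> \<in> path_colorings n C. \<kappa> 0 \<noteq> \<kappa> n}"
  proof (rule bij_betw_byWitness[where f' = "\<lambda>\<kappa>. \<kappa>(Suc n := \<kappa> 0)"])
    show "\<forall>\<kappa>\<in>{\<kappa> \<in> path_colorings (Suc n) C. \<kappa> 0 = \<kappa> (Suc n)}.
        (restrict \<kappa> {..n})(Suc n := restrict \<kappa> {..n} 0) = \<kappa>"
      by (auto simp: path_colorings_def PiE_def extensional_def fun_eq_iff restrict_def le_Suc_eq)
    show "\<forall>\<kappa>\<in>{\<kappa> \<in> path_colorings n C. \<kappa> 0 \<noteq> \<kappa> n}. restrict (\<kappa>(Suc n := \<kappa> 0)) {..n} = \<kappa>"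
      by (auto simp: path_colorings_def PiE_def extensional_def fun_eq_iff restrict_def)
    show "(\<lambda>\<kappa>. restrict \<kappa> {..n}) ` {\<kappa> \<in> path_colorings (Suc n) C. \<kappa> 0 = \<kappa> (Suc n)}
        \<subseteq> {\<kappa> \<in> path_colorings n C. \<kappa> 0 \<noteq> \<kappa> n}"
      by (auto simp: path_colorings_def PiE_def Pi_def)
    show "(\<lambda>\<kappa>. \<kappa>(Suc n := \<kappa> 0)) ` {\<kappa> \<in> path_colorings n C. \<kappa> 0 \<noteq> \<kappa> n}
        \<subseteq> {\<kappa> \<in> path_colorings (Suc n) C. \<kappa> 0 = \<kappa> (Suc n)}"
      by (auto simp: path_colorings_def PiE_def Pi_def extensional_def le_Suc_eq less_Suc_eq)
  qed
  then have "card {\<kappa> \<in> path_colorings n C. \<kappa> 0 \<noteq> \<kappa> n} =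
      card {\<kappa> \<in> path_colorings (Suc n) C. \<kappa> 0 = \<kappa> (Suc n)}"
    by (simp add: bij_betw_same_card)
  moreover have "card {\<kappa> \<in> path_colorings (Suc n) C. \<kappa> 0 \<noteq> \<kappa> (Suc n)} +
      card {\<kappa> \<in> path_colorings (Suc n) C. \<kappa> 0 = \<kappa> (Suc n)} = card (path_colorings (Suc n) C)"
    using fin by (subst card_Un_disjoint[symmetric])
      (auto simp: finite_path_colorings intro!: arg_cong[where f = card])
  ultimately show ?thesis
    using card_path_colorings[OF fin] by simp
qed

text \<open>Deletion and contraction for the cycle with \<open>n + 1\<close> vertices: the
  polynomial of the path on the same vertices minus that of the next shorter cycle. The value 0 at
  the start reflects that the two ends of a one-vertex path coincide and cannot differ in
  color.\<close>

primrec cycle_poly :: "nat \<Rightarrow> rat poly" where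
  "cycle_poly 0 = 0"
| "cycle_poly (Suc n) = [:0, 1:] * [:- 1, 1:] ^ Suc n - cycle_poly n"

lemma poly_cycle_poly:
  "poly (cycle_poly n) (of_nat q) = of_nat (card {\<kappa> \<in> path_colorings n {1..q}. \<kappa> 0 \<noteq> \<kappa> n})"
proof (induction n)
  case 0
  then show ?case by simp
next
  case (Suc n)
  have "(of_nat (card {\<kappa> \<in> path_colorings (Suc n) {1..q}. \<kappa> 0 \<noteq> \<kappa> (Suc n)}) :: rat) +
      of_nat (card {\<kappa> \<in> path_colorings n {1..q}. \<kappa> 0 \<noteq> \<kappa> n}) = of_nat (q * (q - 1) ^ Suc n)"
    using card_path_colorings_distinct_ends[of "{1..q}" n] by (simp flip: of_nat_add)
  moreover have "(of_nat (q * (q - 1) ^ Suc n) :: rat) = of_nat q * (of_nat q - 1) ^ Suc n"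
    by (cases q) (simp_all add: algebra_simps)
  ultimately show ?case
    using Suc.IH by (simp add: poly_power algebra_simps)
qed

lemma coeff_1_cycle_poly: "coeff (cycle_poly n) 1 = (- 1) ^ n * of_nat n"
proof (induction n)
  case (Suc n)
  have "coeff ([:- 1, 1 :: rat:] ^ Suc n) 0 = (- 1) ^ Suc n"
    by (simp add: coeff_0_power)
  then have "coeff ([:0, 1:] * [:- 1, 1 :: rat:] ^ Suc n) 1 = (- 1) ^ Suc n"
    by simp
  then show ?case
    using Suc.IH by (simp add: algebra_simps)
qed simp

text \<open>Vertices are numbered from 0 to \<open>n\<close>, so a cycle with \<open>n + 1\<close>
  vertices gets the value \<open>n\<close>. It is computed on the numbers and carried over along
  \<open>c\<close>.\<close>

lemma linear_chromatic_cycle: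
  assumes n: "2 \<le> n" and inj: "inj_on c {..n}"
    and adj: "\<And>i j. i \<le> n \<Longrightarrow> j \<le> n \<Longrightarrow>
      (c i, c j) \<in> R \<longleftrightarrow> j = Suc i \<or> i = Suc j \<or> i = 0 \<and> j = n \<or> i = n \<and> j = 0"
  shows "linear_chromatic R (c ` {..n}) = of_nat n"
proof -
  define R' :: "nat rel"
    where "R' = {(i, j). j = Suc i \<or> i = Suc j \<or> i = 0 \<and> j = n \<or> i = n \<and> j = 0}"
  have "induced_colorings R' {..n} C = {\<kappa> \<in> path_colorings n C. \<kappa> 0 \<noteq> \<kappa> n}" for C
  proof (intro equalityI subsetI)
    fix \<kappa> assume "\<kappa> \<in> induced_colorings R' {..n} C"
    then have "\<kappa> \<in> {..n} \<rightarrow>\<^sub>E C"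
      and *: "\<And>u w. u \<le> n \<Longrightarrow> w \<le> n \<Longrightarrow> (u, w) \<in> R' \<Longrightarrow> \<kappa> u \<noteq> \<kappa> w"
      by (auto simp: induced_colorings_def)
    then show "\<kappa> \<in> {\<kappa> \<in> path_colorings n C. \<kappa> 0 \<noteq> \<kappa> n}"
      using *[of 0 n] *[of _ "Suc _"] by (auto simp: R'_def path_colorings_def)
  next
    fix \<kappa> assume "\<kappa> \<in> {\<kappa> \<in> path_colorings n C. \<kappa> 0 \<noteq> \<kappa> n}"
    then have "\<kappa> \<in> {..n} \<rightarrow>\<^sub>E C" "\<kappa> 0 \<noteq> \<kappa> n" and *: "\<And>i. i < n \<Longrightarrow> \<kappa> i \<noteq> \<kappa> (Suc i)"
      by (auto simp: path_colorings_def)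
    then show "\<kappa> \<in> induced_colorings R' {..n} C"
      by (auto simp: R'_def induced_colorings_def dest: sym)
  qed
  then have "chromatic_poly R' {..n} = cycle_poly n"
    by (intro chromatic_polyI) (simp_all add: poly_cycle_poly)
  then have "linear_chromatic R' {..n} = of_nat n"
    using coeff_1_cycle_poly[of n] by (simp add: linear_chromatic_def)
  moreover have "linear_chromatic R (c ` {..n}) = linear_chromatic R' {..n}"
    using inj adj by (intro linear_chromatic_image) (auto simp: R'_def)
  ultimately show ?thesis by simp
qed

section \<open>Invariants of the chromatic symmetric function\<close>

lemma pair_graphD:
  assumes "pair_graph G"
  shows "finite (pverts G)" "parcs G \<subseteq> pverts G \<times> pverts G" "sym (parcs G)" "(x, x) \<notin> parcs G"
proof -
  interpret pair_graph G by fact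
  show "finite (pverts G)" by (rule pair_finite_verts)
  show "parcs G \<subseteq> pverts G \<times> pverts G" using in_arcsD1 in_arcsD2 by auto
  show "sym (parcs G)" using pair_sym_arcs by (simp add: symmetric_def)
  show "(x, x) \<notin> parcs G" using pair_no_loops[of "(x, x)"] by auto
qed

lemma lookup_coloring_monomial:
  assumes "finite (pverts G)"
  shows "Poly_Mapping.lookup (coloring_monomial G \<kappa>) i = card {x \<in> pverts G. \<kappa> x = i}"
proof -
  have "Poly_Mapping.lookup (coloring_monomial G \<kappa>) i = (\<Sum>x\<in>pverts G. if \<kappa> x = i then 1 else 0)"
    unfolding coloring_monomial_def lookup_sum lookup_single when_def ..
  also have "\<dots> = (\<Sum>x | x \<in> pverts G \<and> \<kappa> x = i. 1)"
    using assms by (intro sum.inter_filter[symmetric])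
  finally show ?thesis by simp
qed

lemma keys_coloring_monomial:
  assumes "finite (pverts G)"
  shows "Poly_Mapping.keys (coloring_monomial G \<kappa>) = \<kappa> ` pverts G"
  using assms by (auto simp: in_keys_iff lookup_coloring_monomial)

text \<open>Makes the size of a union of color classes a function of the monomial alone, so that it
  is preserved by every map of colorings that preserves monomials.\<close>

lemma card_coloring_vimage:
  assumes fin: "finite (pverts G)"
  shows "card {x \<in> pverts G. \<kappa> x \<in> D} =
    (\<Sum>i\<in>Poly_Mapping.keys (coloring_monomial G \<kappa>) \<inter> D.
      Poly_Mapping.lookup (coloring_monomial G \<kappa>) i)"
proof -
  have "{x \<in> pverts G. \<kappa> x \<in> D} = (\<Union>i\<in>\<kappa> ` pverts G \<inter> D. {x \<in> pverts G. \<kappa> x = i})"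
    by auto
  also have "card \<dots> = (\<Sum>i\<in>\<kappa> ` pverts G \<inter> D. card {x \<in> pverts G. \<kappa> x = i})"
    using fin by (intro card_UN_disjoint) auto
  finally show ?thesis
    using fin by (simp add: keys_coloring_monomial lookup_coloring_monomial)
qed

text \<open>Equal coefficients mean that over every monomial the two fibers are finite sets of the
  same size; bijections between the fibers are glued together. The rest of the proof uses the
  equality of the symmetric functions only in this form.\<close>

lemma ex_monomial_preserving_bij:
  assumes G: "pair_graph G" and H: "pair_graph H"
    and eq: "chromatic_symmetric_function G = chromatic_symmetric_function H"
  shows "\<exists>b. bij_betw b (proper_colorings G) (proper_colorings H) \<and>
    (\<forall>\<kappa>\<in>proper_colorings G. coloring_monomial H (b \<kappa>) = coloring_monomial G \<kappa>)"
proof -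
  define F where "F m = {\<kappa> \<in> proper_colorings G. coloring_monomial G \<kappa> = m}" for m
  define F' where "F' m = {\<kappa> \<in> proper_colorings H. coloring_monomial H \<kappa> = m}" for m
  have "\<exists>b. bij_betw b (F m) (F' m)" for m
  proof (rule finite_same_card_bij)
    show "finite (F m)" "finite (F' m)"
      unfolding F_def F'_def
      using finite_proper_colorings_monomial G H by blast+
    show "card (F m) = card (F' m)"
      using fun_cong[OF eq, of m] by (simp add: F_def F'_def chromatic_symmetric_function_def)
  qed
  then obtain b where b: "\<And>m. bij_betw (b m) (F m) (F' m)"
    by metis
  define b' where "b' \<kappa> = b (coloring_monomial G \<kappa>) \<kappa>" for \<kappa>
  have b': "b' \<kappa> \<in> F' (coloring_monomial G \<kappa>)" if "\<kappa> \<in> proper_colorings G" for \<kappa>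
    using bij_betwE[OF b, of "coloring_monomial G \<kappa>"] that by (auto simp: b'_def F_def)
  have "bij_betw b' (proper_colorings G) (proper_colorings H)"
  proof (rule bij_betw_imageI)
    show "inj_on b' (proper_colorings G)"
    proof (rule inj_onI)
      fix \<kappa> \<mu> assume *: "\<kappa> \<in> proper_colorings G" "\<mu> \<in> proper_colorings G" "b' \<kappa> = b' \<mu>"
      then have "coloring_monomial G \<kappa> = coloring_monomial G \<mu>"
        using b'[of \<kappa>] b'[of \<mu>] by (simp add: F'_def)
      with * show "\<kappa> = \<mu>"
        using bij_betw_imp_inj_on[OF b, of "coloring_monomial G \<mu>"]
        by (auto simp: inj_on_def b'_def F_def)
    qed
    show "b' ` proper_colorings G = proper_colorings H"
    proof (intro equalityI subsetI)
      fix \<mu> assume "\<mu> \<in> b' ` proper_colorings G"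
      then show "\<mu> \<in> proper_colorings H"
        using b' by (auto simp: F'_def)
    next
      fix \<mu> assume "\<mu> \<in> proper_colorings H"
      then have "\<mu> \<in> F' (coloring_monomial H \<mu>)"
        by (simp add: F'_def)
      then obtain \<kappa> where "\<kappa> \<in> F (coloring_monomial H \<mu>)" "b (coloring_monomial H \<mu>) \<kappa> = \<mu>"
        using bij_betw_imp_surj_on[OF b] by (metis imageE)
      then show "\<mu> \<in> b' ` proper_colorings G"
        by (intro image_eqI[of _ _ \<kappa>]) (auto simp: F_def b'_def)
    qed
  qed
  then show ?thesis
    using b' by (auto simp: F'_def)
qed

lemma proper_colorings_bounded:
  assumes "pair_graph G"
  shows "induced_colorings (parcs G) (pverts G) {1..q} =
    {\<kappa> \<in> proper_colorings G. \<kappa> ` pverts G \<subseteq> {1..q}}"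
  using pair_graphD(2)[OF assms]
  by (auto simp: induced_colorings_def proper_colorings_def PiE_def Pi_def)

locale same_chromatic =
  fixes G :: "'a pair_pre_digraph" and H :: "'b pair_pre_digraph"
  assumes G: "pair_graph G" and H: "pair_graph H"
    and same: "chromatic_symmetric_function G = chromatic_symmetric_function H"
begin

lemma profile_preserving_bij:
  obtains b where "bij_betw b (proper_colorings G) (proper_colorings H)"
    "\<And>\<kappa>. \<kappa> \<in> proper_colorings G \<Longrightarrow> b \<kappa> ` pverts H = \<kappa> ` pverts G"
    "\<And>\<kappa> D. \<kappa> \<in> proper_colorings G \<Longrightarrow>
      card {x \<in> pverts H. b \<kappa> x \<in> D} = card {x \<in> pverts G. \<kappa> x \<in> D}"
proof -
  obtain b where b: "bij_betw b (proper_colorings G) (proper_colorings H)"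
    "\<forall>\<kappa>\<in>proper_colorings G. coloring_monomial H (b \<kappa>) = coloring_monomial G \<kappa>"
    using ex_monomial_preserving_bij[OF G H same] by blast
  have "b \<kappa> ` pverts H = \<kappa> ` pverts G" if "\<kappa> \<in> proper_colorings G" for \<kappa>
    using b(2) that keys_coloring_monomial[OF pair_graphD(1)[OF G], of \<kappa>]
      keys_coloring_monomial[OF pair_graphD(1)[OF H], of "b \<kappa>"] by simp
  moreover have "card {x \<in> pverts H. b \<kappa> x \<in> D} = card {x \<in> pverts G. \<kappa> x \<in> D}"
    if "\<kappa> \<in> proper_colorings G" for \<kappa> D
    using b(2) that pair_graphD(1)[OF G] pair_graphD(1)[OF H] by (simp add: card_coloring_vimage)
  ultimately show ?thesis
    by (rule that[OF b(1)])
qed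

text \<open>The number of vertices is the degree of any monomial that occurs, read off with
  \<open>D = UNIV\<close>. An injective coloring guarantees that some monomial occurs.\<close>

lemma same_card_verts: "card (pverts G) = card (pverts H)"
proof -
  obtain b where b: "\<And>\<kappa> D. \<kappa> \<in> proper_colorings G \<Longrightarrow>
      card {x \<in> pverts H. b \<kappa> x \<in> D} = card {x \<in> pverts G. \<kappa> x \<in> D}"
    by (rule profile_preserving_bij) (rule that)
  obtain h :: "'a \<Rightarrow> nat" where h: "inj_on h (pverts G)"
    using finite_imp_inj_to_nat_seg[OF pair_graphD(1)[OF G]] by blast
  \<comment> \<open>The shift by \<open>Suc\<close> is due to colors starting at 1.\<close>
  have "restrict (\<lambda>x. Suc (h x)) (pverts G) \<in> proper_colorings G"
  proof -
    have "h u \<noteq> h w" "u \<in> pverts G" "w \<in> pverts G" if "(u, w) \<in> parcs G" for u w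
      using that pair_graphD(2,4)[OF G] h by (auto simp: inj_on_def)
    then show ?thesis
      by (auto simp: proper_colorings_def)
  qed
  from b[OF this] have "card {x \<in> pverts H. b (restrict (\<lambda>x. Suc (h x)) (pverts G)) x \<in> UNIV} =
      card {x \<in> pverts G. restrict (\<lambda>x. Suc (h x)) (pverts G) x \<in> UNIV}" .
  then show ?thesis by simp
qed

text \<open>Both the bound \<open>q\<close> on the colors and the number of vertices colored from
  \<open>D\<close> can be read off the monomial.\<close>

lemma same_card_colorings:
  "card {\<kappa> \<in> induced_colorings (parcs G) (pverts G) {1..q}. card {x \<in> pverts G. \<kappa> x \<in> D} = j} =
   card {\<kappa> \<in> induced_colorings (parcs H) (pverts H) {1..q}. card {x \<in> pverts H. \<kappa> x \<in> D} = j}"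
proof -
  obtain b where b: "bij_betw b (proper_colorings G) (proper_colorings H)"
    and img: "\<And>\<kappa>. \<kappa> \<in> proper_colorings G \<Longrightarrow> b \<kappa> ` pverts H = \<kappa> ` pverts G"
    and crd: "\<And>\<kappa> D. \<kappa> \<in> proper_colorings G \<Longrightarrow>
      card {x \<in> pverts H. b \<kappa> x \<in> D} = card {x \<in> pverts G. \<kappa> x \<in> D}"
    by (rule profile_preserving_bij) (rule that)
  have "bij_betw b
      {\<kappa> \<in> proper_colorings G. \<kappa> ` pverts G \<subseteq> {1..q} \<and> card {x \<in> pverts G. \<kappa> x \<in> D} = j}
      {\<kappa> \<in> proper_colorings H. \<kappa> ` pverts H \<subseteq> {1..q} \<and> card {x \<in> pverts H. \<kappa> x \<in> D} = j}"
  proof (rule bij_betw_subset[OF b])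
    show "b ` {\<kappa> \<in> proper_colorings G. \<kappa> ` pverts G \<subseteq> {1..q} \<and> card {x \<in> pverts G. \<kappa> x \<in> D} = j} =
      {\<kappa> \<in> proper_colorings H. \<kappa> ` pverts H \<subseteq> {1..q} \<and> card {x \<in> pverts H. \<kappa> x \<in> D} = j}"
      (is "b ` ?S = ?T")
    proof (intro equalityI subsetI)
      fix \<mu> assume "\<mu> \<in> b ` ?S"
      then obtain \<kappa> where \<kappa>: "\<kappa> \<in> ?S" "\<mu> = b \<kappa>" by blast
      then show "\<mu> \<in> ?T"
        using img[of \<kappa>] crd[of \<kappa>] bij_betwE[OF b] by simp
    next
      fix \<mu> assume \<mu>: "\<mu> \<in> ?T"
      then obtain \<kappa> where "\<kappa> \<in> proper_colorings G" "\<mu> = b \<kappa>"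
        using bij_betw_imp_surj_on[OF b] by blast
      then show "\<mu> \<in> b ` ?S"
        using \<mu> img[of \<kappa>] crd[of \<kappa>] by simp
    qed
  qed auto
  then have "card {\<kappa> \<in> proper_colorings G.
        \<kappa> ` pverts G \<subseteq> {1..q} \<and> card {x \<in> pverts G. \<kappa> x \<in> D} = j} =
      card {\<kappa> \<in> proper_colorings H.
        \<kappa> ` pverts H \<subseteq> {1..q} \<and> card {x \<in> pverts H. \<kappa> x \<in> D} = j}"
    by (rule bij_betw_same_card)
  then show ?thesis
    unfolding proper_colorings_bounded[OF G] proper_colorings_bounded[OF H]
    by (simp add: conj_assoc)
qed

lemma same_linear_chromatic:
  "linear_chromatic (parcs G) (pverts G) = linear_chromatic (parcs H) (pverts H)"
proof -
  \<comment> \<open>With \<open>D\<close> empty and \<open>j = 0\<close> the condition on class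
    sizes is void, which leaves all colorings with \<open>q\<close> colors.\<close>
  have "chromatic_poly (parcs G) (pverts G) = chromatic_poly (parcs H) (pverts H)"
    using same_card_colorings[of _ "{}" 0] pair_graphD(1)[OF G] pair_graphD(1)[OF H]
    by (intro poly_eqI_of_nat) (simp add: poly_chromatic_poly)
  then show ?thesis
    by (simp add: linear_chromatic_def same_card_verts)
qed

end

section \<open>Two palettes and the weighted count of splittings\<close>

lemma card_eq_sum_fibers:
  assumes "finite S" "finite T" "f ` S \<subseteq> T"
  shows "card S = (\<Sum>y\<in>T. card {x \<in> S. f x = y})"
  using sum.group[OF assms, of "\<lambda>_. 1::nat"] by simp

lemma card_colorings_two_palettes:
  assumes fin: "finite V"
  shows "card {\<kappa> \<in> induced_colorings R V {1..q + r}. card {x \<in> V. \<kappa> x \<in> {q + 1..q + r}} = j} =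
    (\<Sum>A | A \<subseteq> V \<and> card A = j.
      card (induced_colorings R A {1..r}) * card (induced_colorings R (V - A) {1..q}))"
proof -
  have fs: "finite {A. A \<subseteq> V \<and> card A = j}"
    using fin by simp
  have disj: "{1..q} \<inter> {q + 1..q + r} = {}"
    by auto
  have un: "{1..q} \<union> {q + 1..q + r} = {1..q + r}"
    by auto
  define f where "f \<kappa> = {x \<in> V. \<kappa> x \<in> {q + 1..q + r}}" for \<kappa>
  let ?S = "{\<kappa> \<in> induced_colorings R V {1..q + r}. card (f \<kappa>) = j}"
  have "card ?S = (\<Sum>A | A \<subseteq> V \<and> card A = j. card {\<kappa> \<in> ?S. f \<kappa> = A})"
    using fs fin by (intro card_eq_sum_fibers) (auto simp: f_def finite_induced_colorings)
  also have "\<dots> = (\<Sum>A | A \<subseteq> V \<and> card A = j. card {\<kappa> \<in> induced_colorings R V {1..q + r}. f \<kappa> = A})"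
    by (intro sum.cong refl arg_cong[where f = card]) auto
  also have "\<dots> = (\<Sum>A | A \<subseteq> V \<and> card A = j.
      card (induced_colorings R A {1..r}) * card (induced_colorings R (V - A) {1..q}))"
    unfolding f_def
  proof (intro sum.cong refl)
    fix A assume "A \<in> {A. A \<subseteq> V \<and> card A = j}"
    then have A: "A \<subseteq> V" "finite A"
      using fin finite_subset by auto
    have "card {\<kappa> \<in> induced_colorings R V {1..q + r}. {x \<in> V. \<kappa> x \<in> {q + 1..q + r}} = A} =
        card (induced_colorings R A {q + 1..q + r}) * card (induced_colorings R (V - A) {1..q})"
      using card_induced_colorings_split[OF A(1) disj, of R] unfolding un .
    also have "card (induced_colorings R A {q + 1..q + r}) = card (induced_colorings R A {1..r})"
      using A(2) by (intro card_induced_colorings_eq) auto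
    finally show "card {\<kappa> \<in> induced_colorings R V {1..q + r}. {x \<in> V. \<kappa> x \<in> {q + 1..q + r}} = A} =
        card (induced_colorings R A {1..r}) * card (induced_colorings R (V - A) {1..q})" .
  qed
  finally show ?thesis
    unfolding f_def .
qed

lemma poly_two_palettes:
  assumes fin: "finite V"
  shows "(\<Sum>A | A \<subseteq> V \<and> card A = j.
      poly (chromatic_poly R A) (of_nat r) * poly (chromatic_poly R (V - A)) (of_nat q)) =
    of_nat (card {\<kappa> \<in> induced_colorings R V {1..q + r}. card {x \<in> V. \<kappa> x \<in> {q + 1..q + r}} = j})"
  unfolding card_colorings_two_palettes[OF fin] of_nat_sum of_nat_mult
proof (intro sum.cong refl)
  fix A assume "A \<in> {A. A \<subseteq> V \<and> card A = j}"
  then have "finite A" "finite (V - A)"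
    using fin finite_subset by auto
  then show "poly (chromatic_poly R A) (of_nat r) * poly (chromatic_poly R (V - A)) (of_nat q) =
      of_nat (card (induced_colorings R A {1..r})) * of_nat (card (induced_colorings R (V - A) {1..q}))"
    by (simp only: poly_chromatic_poly)
qed

text \<open>For \<open>0 < j < n\<close> with \<open>2 j \<noteq> n\<close>, where \<open>n = card V\<close>, this is up to sign the coefficient of
  \<open>p\<^sub>j p\<^sub>n\<^sub>-\<^sub>j\<close> in the power sum expansion of the chromatic symmetric function.\<close>

definition split_weight :: "'a rel \<Rightarrow> 'a set \<Rightarrow> nat \<Rightarrow> rat" where
  "split_weight R V j =
     (\<Sum>A | A \<subseteq> V \<and> card A = j. linear_chromatic R A * linear_chromatic R (V - A))"

lemma split_weight_eq_coeff:
  assumes fin: "finite V"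
  shows "split_weight R V j = (- 1) ^ card V * (\<Sum>A | A \<subseteq> V \<and> card A = j.
    coeff (chromatic_poly R A) 1 * coeff (chromatic_poly R (V - A)) 1)"
  unfolding split_weight_def sum_distrib_left
proof (intro sum.cong refl)
  fix A assume "A \<in> {A. A \<subseteq> V \<and> card A = j}"
  then have A: "A \<subseteq> V" by simp
  have "card A + card (V - A) = card V"
    using A fin card_mono[OF fin A] by (simp add: card_Diff_subset finite_subset)
  \<comment> \<open>The exponents of the two signs add up to \<open>card V + 2\<close>.\<close>
  then have "(- 1) ^ card V = ((- 1) ^ Suc (card A) * (- 1) ^ Suc (card (V - A)) :: rat)"
    by (simp flip: power_add)
  then show "linear_chromatic R A * linear_chromatic R (V - A) =
      (- 1) ^ card V * (coeff (chromatic_poly R A) 1 * coeff (chromatic_poly R (V - A)) 1)"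
    by (simp only: linear_chromatic_def mult_ac)
qed

text \<open>The coefficient of \<open>q r\<close> is extracted one variable at a time, which avoids
  bivariate polynomials: for fixed \<open>r\<close> the identity is one between polynomials in
  \<open>q\<close>, and after passing to linear coefficients \<open>r\<close> becomes the
  variable.\<close>

lemma (in same_chromatic) same_split_weight:
  "split_weight (parcs G) (pverts G) j = split_weight (parcs H) (pverts H) j"
proof -
  let ?c = chromatic_poly
  let ?SG = "{A. A \<subseteq> pverts G \<and> card A = j}"
  let ?SH = "{A. A \<subseteq> pverts H \<and> card A = j}"
  have fin: "finite (pverts G)" "finite (pverts H)"
    using pair_graphD(1)[OF G] pair_graphD(1)[OF H] by auto
  have eq: "(\<Sum>A\<in>?SG. poly (?c (parcs G) A) (of_nat r) * poly (?c (parcs G) (pverts G - A)) (of_nat q)) =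
      (\<Sum>A\<in>?SH. poly (?c (parcs H) A) (of_nat r) * poly (?c (parcs H) (pverts H - A)) (of_nat q))"
    for q r
    unfolding poly_two_palettes[OF fin(1)] poly_two_palettes[OF fin(2)] same_card_colorings ..
  have "(\<Sum>A\<in>?SG. smult (poly (?c (parcs G) A) (of_nat r)) (?c (parcs G) (pverts G - A))) =
      (\<Sum>A\<in>?SH. smult (poly (?c (parcs H) A) (of_nat r)) (?c (parcs H) (pverts H - A)))" for r
    using eq by (intro poly_eqI_of_nat) (simp add: poly_sum)
  from arg_cong[OF this, of "\<lambda>p. coeff p 1"]
  have "(\<Sum>A\<in>?SG. smult (coeff (?c (parcs G) (pverts G - A)) 1) (?c (parcs G) A)) =
      (\<Sum>A\<in>?SH. smult (coeff (?c (parcs H) (pverts H - A)) 1) (?c (parcs H) A))"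
    by (intro poly_eqI_of_nat) (simp add: poly_sum coeff_sum mult.commute)
  from arg_cong[OF this, of "\<lambda>p. coeff p 1"] show ?thesis
    using fin by (simp add: split_weight_eq_coeff same_card_verts coeff_sum mult.commute)
qed

section \<open>Connected splittings of a squid\<close>

text \<open>The hub is \<open>(0, 0)\<close>, the cycle consists of the vertices \<open>(0, i)\<close>, and tentacle \<open>k\<close> of the
  vertices \<open>(Suc k, i)\<close>, numbered from 1 at the hub.\<close>

definition std_verts :: "nat \<Rightarrow> nat list \<Rightarrow> (nat \<times> nat) set" where
  "std_verts m ls = {(0, i) | i. i < m} \<union> {(Suc k, i) | k i. k < length ls \<and> 1 \<le> i \<and> i \<le> ls ! k}"

definition std_step :: "nat \<Rightarrow> nat \<times> nat \<Rightarrow> nat \<times> nat \<Rightarrow> bool" where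
  "std_step m x y \<longleftrightarrow> fst x = fst y \<and> snd y = Suc (snd x) \<or> x = (0, m - 1) \<and> y = (0, 0) \<or>
     x = (0, 0) \<and> 0 < fst y \<and> snd y = 1"

definition std_arcs :: "nat \<Rightarrow> nat list \<Rightarrow> (nat \<times> nat) rel" where
  "std_arcs m ls = {(x, y). x \<in> std_verts m ls \<and> y \<in> std_verts m ls \<and> (std_step m x y \<or> std_step m y x)}"

definition std_squid :: "nat \<Rightarrow> nat list \<Rightarrow> (nat \<times> nat) pair_pre_digraph" where
  "std_squid m ls = \<lparr>pverts = std_verts m ls, parcs = std_arcs m ls\<rparr>"

lemma std_verts_iff:
  "(a, i) \<in> std_verts m ls \<longleftrightarrow>
    (if a = 0 then i < m else a \<le> length ls \<and> 1 \<le> i \<and> i \<le> ls ! (a - 1))"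
  by (cases a) (auto simp: std_verts_def)

lemma std_arcs_iff:
  "((a, i), (b, j)) \<in> std_arcs m ls \<longleftrightarrow> (a, i) \<in> std_verts m ls \<and> (b, j) \<in> std_verts m ls \<and>
    (a = b \<and> (j = Suc i \<or> i = Suc j) \<or>
     a = 0 \<and> b = 0 \<and> (i = m - 1 \<and> j = 0 \<or> i = 0 \<and> j = m - 1) \<or>
     a = 0 \<and> i = 0 \<and> 0 < b \<and> j = 1 \<or> b = 0 \<and> j = 0 \<and> 0 < a \<and> i = 1)"
  by (auto simp: std_arcs_def std_step_def)

lemma std_verts_eq_union:
  "std_verts m ls = {0} \<times> {..<m} \<union> (\<Union>k<length ls. {Suc k} \<times> {1..ls ! k})"
  by (auto simp: std_verts_def)

lemma finite_std_verts: "finite (std_verts m ls)"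
  by (simp add: std_verts_eq_union)

lemma card_std_verts: "card (std_verts m ls) = m + sum_list ls"
proof -
  have "card (\<Union>k<length ls. {Suc k} \<times> {1..ls ! k}) = (\<Sum>k<length ls. card ({Suc k} \<times> {1..ls ! k}))"
    by (intro card_UN_disjoint) auto
  then have "card (\<Union>k<length ls. {Suc k} \<times> {1..ls ! k}) = sum_list ls"
    by (simp add: card_cartesian_product sum_list_sum_nth atLeast0LessThan)
  then show ?thesis
    unfolding std_verts_eq_union by (subst card_Un_disjoint) (auto simp: card_cartesian_product)
qed

lemma sym_std_arcs: "sym (std_arcs m ls)"
  by (auto simp: std_arcs_def sym_def)

lemma std_arcs_irrefl:
  assumes "2 \<le> m"
  shows "(x, x) \<notin> std_arcs m ls"
  using assms by (cases x) (auto simp: std_arcs_iff)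

lemma pair_graph_std_squid:
  assumes "2 \<le> m"
  shows "pair_graph (std_squid m ls)"
proof
  have "std_arcs m ls \<subseteq> std_verts m ls \<times> std_verts m ls"
    by (auto simp: std_arcs_def)
  then show "finite (parcs (std_squid m ls))"
    using finite_std_verts finite_subset by (fastforce simp: std_squid_def)
  show "fst e \<noteq> snd e" if "e \<in> parcs (std_squid m ls)" for e
    using that std_arcs_irrefl[OF assms, of "fst e" ls] by (cases e) (auto simp: std_squid_def)
  show "symmetric (with_proj (std_squid m ls))"
    using sym_std_arcs by (simp add: symmetric_def std_squid_def)
qed (auto simp: std_squid_def finite_std_verts std_arcs_def)

text \<open>Contrapositive of \<open>linear_chromatic_disconnected\<close>, in the form in which
  splittings are analysed: a nonzero value forces an edge out of every proper nonempty part.\<close>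

lemma linear_chromatic_connected:
  assumes "linear_chromatic R B \<noteq> 0" "finite B" "S \<subseteq> B" "S \<noteq> {}" "S \<noteq> B" "sym R"
  shows "\<exists>u\<in>S. \<exists>w\<in>B - S. (u, w) \<in> R"
proof (rule ccontr)
  assume no: "\<not> ?thesis"
  then have "linear_chromatic R (S \<union> (B - S)) = 0"
    using assms finite_subset[OF assms(3,2)]
    by (intro linear_chromatic_disconnected) (auto dest: symD)
  then show False
    using assms by (simp add: Un_absorb1)
qed

section \<open>Linear coefficients of the parts of a model squid\<close>

locale squid_model =
  fixes m :: nat and ls :: "nat list"
  assumes m: "3 \<le> m" and ls: "\<And>l. l \<in> set ls \<Longrightarrow> 1 \<le> l"
begin

abbreviation "V \<equiv> std_verts m ls"
abbreviation "R \<equiv> std_arcs m ls"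
abbreviation "\<beta> \<equiv> linear_chromatic R"
abbreviation "hub \<equiv> (0::nat, 0::nat)"

lemma hub_in_V: "hub \<in> V"
  using m by (simp add: std_verts_iff)

lemma irrefl: "(x, x) \<notin> R"
  using std_arcs_irrefl m by simp

lemma leaf:
  assumes "w \<notin> A" "u \<in> A" "finite A" "\<And>x. x \<in> A \<Longrightarrow> (w, x) \<in> R \<longleftrightarrow> x = u"
  shows "\<beta> (insert w A) = \<beta> A"
  using assms by (intro linear_chromatic_insert_leaf) (auto simp: sym_std_arcs irrefl)

text \<open>The tentacles, each cut off after its first \<open>c k\<close> vertices. The whole squid
  and the complement of a tentacle end both consist of the cycle and such a set.\<close>

definition arms :: "(nat \<Rightarrow> nat) \<Rightarrow> (nat \<times> nat) set" where
  "arms c = {(Suc k, i) | k i. k < length ls \<and> 1 \<le> i \<and> i \<le> c k}"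

lemma arms_iff: "(a, i) \<in> arms c \<longleftrightarrow> 1 \<le> a \<and> a \<le> length ls \<and> 1 \<le> i \<and> i \<le> c (a - 1)"
  by (cases a) (auto simp: arms_def)

text \<open>The outermost vertex of a nonempty tentacle is pendant and can be stripped.
  \<open>W\<close> may be any part of the cycle that contains the hub, which covers the full cycle
  and the cycle with a segment removed.\<close>

lemma linear_chromatic_arms:
  assumes W: "W \<subseteq> {0} \<times> {..<m}" "hub \<in> W"
    and c: "\<And>k. k < length ls \<Longrightarrow> c k \<le> ls ! k"
  shows "\<beta> (W \<union> arms c) = \<beta> W"
  using c
proof (induction "\<Sum>k<length ls. c k" arbitrary: c)
  case 0
  then have "arms c = {}"
    by (auto simp: arms_def)
  then show ?case by simp
next
  case (Suc n)
  have "\<not> (\<forall>k<length ls. c k = 0)"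
  proof
    assume "\<forall>k<length ls. c k = 0"
    then have "(\<Sum>k<length ls. c k) = 0" by simp
    then show False using Suc.hyps(2) by simp
  qed
  then obtain k where k: "k < length ls" "0 < c k"
    by auto
  define c' where "c' = c(k := c k - 1)"
  have c'_le: "c' k' \<le> ls ! k'" if "k' < length ls" for k'
    using Suc.prems[OF that] by (auto simp: c'_def)
  have "(\<Sum>k<length ls. c k) = c k + sum c ({..<length ls} - {k})"
    using k by (intro sum.remove) auto
  moreover have "(\<Sum>k<length ls. c' k) = c' k + sum c' ({..<length ls} - {k})"
    using k by (intro sum.remove) auto
  moreover have "sum c ({..<length ls} - {k}) = sum c' ({..<length ls} - {k})"
    by (intro sum.cong) (auto simp: c'_def)
  moreover have "c' k + 1 = c k"
    using k by (simp add: c'_def)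
  ultimately have "n = (\<Sum>k<length ls. c' k)"
    using Suc.hyps(2) by linarith
  then have IH: "\<beta> (W \<union> arms c') = \<beta> W"
    using c'_le by (rule Suc.hyps(1))
  \<comment> \<open>The neighbor one step closer to the hub; position 0 of a tentacle is the hub
    itself.\<close>
  define u where "u = (if c k = 1 then hub else (Suc k, c k - 1))"
  have "arms c = insert (Suc k, c k) (arms c')"
  proof (intro set_eqI)
    fix x :: "nat \<times> nat"
    obtain b j where "x = (b, j)" by fastforce
    then show "x \<in> arms c \<longleftrightarrow> x \<in> insert (Suc k, c k) (arms c')"
      using k by (cases "b - 1 = k") (auto simp: arms_iff c'_def)
  qed
  then have ins: "W \<union> arms c = insert (Suc k, c k) (W \<union> arms c')"
    by simp
  have sub: "W \<union> arms c' \<subseteq> V"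
    using W c'_le by (fastforce simp: arms_def std_verts_iff)
  have "\<beta> (insert (Suc k, c k) (W \<union> arms c')) = \<beta> (W \<union> arms c')"
  proof (rule leaf)
    show "(Suc k, c k) \<notin> W \<union> arms c'"
      using W k by (auto simp: arms_def c'_def)
    show "u \<in> W \<union> arms c'"
      using W k by (auto simp: u_def arms_def c'_def)
    show "finite (W \<union> arms c')"
      using sub finite_std_verts finite_subset by blast
    have kV: "(Suc k, c k) \<in> V"
      using k Suc.prems by (auto simp: std_verts_iff)
    fix x assume x: "x \<in> W \<union> arms c'"
    obtain b j where bj: "x = (b, j)" by fastforce
    have "(b, j) \<in> V"
      using x sub bj by auto
    then have "((Suc k, c k), (b, j)) \<in> R \<longleftrightarrow> b = Suc k \<and> (j = Suc (c k) \<or> c k = Suc j) \<or>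
        b = 0 \<and> j = 0 \<and> c k = 1"
      using kV by (auto simp: std_arcs_iff)
    also have "\<dots> \<longleftrightarrow> (b, j) = u"
      using x W k by (auto simp: bj u_def arms_def c'_def)
    finally show "((Suc k, c k), x) \<in> R \<longleftrightarrow> x = u"
      by (simp add: bj)
  qed
  then show ?case
    by (simp add: ins IH)
qed

text \<open>The interval grows at its upper end by pendant vertices. The second hypothesis keeps an
  interval that starts at the hub from closing up to the whole cycle.\<close>

lemma linear_chromatic_interval:
  assumes "{k} \<times> {a..a + l} \<subseteq> V" "(k, a) = hub \<Longrightarrow> a + l < m - 1"
  shows "\<beta> ({k} \<times> {a..a + l}) = 1"
  using assms
proof (induction l)
  case 0
  then show ?case
    by (simp add: linear_chromatic_single irrefl)
next
  case (Suc l)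
  have "\<beta> (insert (k, a + Suc l) ({k} \<times> {a..a + l})) = \<beta> ({k} \<times> {a..a + l})"
  proof (rule leaf[where u = "(k, a + l)"])
    fix x assume "x \<in> {k} \<times> {a..a + l}"
    then obtain i where i: "x = (k, i)" "a \<le> i" "i \<le> a + l" by auto
    have "(k, i) \<in> V" "(k, a + Suc l) \<in> V"
      using Suc.prems(1) i by auto
    then show "((k, a + Suc l), x) \<in> R \<longleftrightarrow> x = (k, a + l)"
      using i Suc.prems(2) by (auto simp: std_arcs_iff)
  qed auto
  moreover have "insert (k, a + Suc l) ({k} \<times> {a..a + l}) = {k} \<times> {a..a + Suc l}"
    by auto
  moreover have "\<beta> ({k} \<times> {a..a + l}) = 1"
  proof (rule Suc.IH)
    show "{k} \<times> {a..a + l} \<subseteq> V"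
      using Suc.prems(1) by auto
  qed (use Suc.prems(2) in auto)
  ultimately show ?case by simp
qed

text \<open>What remains of the cycle is a path through the hub. It grows from \<open>{..<a}\<close>
  by the pendant vertices \<open>m - 1\<close>, \<open>m - 2\<close>, ... in descending order, the
  first of which is attached to the hub.\<close>

lemma linear_chromatic_broken_cycle:
  assumes "1 \<le> a" "a < b" "b \<le> m"
  shows "\<beta> ({0} \<times> ({..<a} \<union> {b..<m})) = 1"
  using assms(3,2)
proof (induction rule: inc_induct)
  case base
  have "{0::nat} \<times> ({..<a} \<union> {m..<m}) = {0} \<times> {0..0 + (a - 1)}"
    using assms(1) by auto
  moreover have "\<beta> ({0} \<times> {0..0 + (a - 1)}) = 1"
    using base assms(1) by (intro linear_chromatic_interval) (auto simp: std_verts_iff)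
  ultimately show ?case by simp
next
  case (step b)
  define u where "u = (0::nat, if Suc b = m then 0 else Suc b)"
  have "\<beta> (insert (0, b) ({0} \<times> ({..<a} \<union> {Suc b..<m}))) = \<beta> ({0} \<times> ({..<a} \<union> {Suc b..<m}))"
  proof (rule leaf[where u = u])
    fix x assume "x \<in> {0::nat} \<times> ({..<a} \<union> {Suc b..<m})"
    then show "((0, b), x) \<in> R \<longleftrightarrow> x = u"
      using step.hyps step.prems assms(1) by (auto simp: std_arcs_iff std_verts_iff u_def)
  qed (use step.hyps step.prems assms(1) in \<open>auto simp: u_def\<close>)
  moreover have "insert (0::nat, b) ({0} \<times> ({..<a} \<union> {Suc b..<m})) = {0} \<times> ({..<a} \<union> {b..<m})"
    using step.hyps by auto
  ultimately show ?case
    using step.IH step.prems by simp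
qed

lemma linear_chromatic_whole_cycle: "\<beta> ({0} \<times> {..<m}) = of_nat (m - 1)"
proof -
  have "{0::nat} \<times> {..<m} = Pair 0 ` {..m - 1}"
    using m by (auto simp: image_iff)
  moreover have "\<beta> (Pair 0 ` {..m - 1}) = of_nat (m - 1)"
    using m by (intro linear_chromatic_cycle) (auto simp: inj_on_def std_arcs_iff std_verts_iff)
  ultimately show ?thesis by simp
qed

lemma V_eq_arms: "V = {0} \<times> {..<m} \<union> arms (\<lambda>k. ls ! k)"
  by (auto simp: std_verts_def arms_def)

lemma linear_chromatic_V: "\<beta> V = of_nat (m - 1)"
  unfolding V_eq_arms using m by (subst linear_chromatic_arms) (auto simp: linear_chromatic_whole_cycle)

definition tip :: "nat \<Rightarrow> nat \<Rightarrow> (nat \<times> nat) set" where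
  "tip j k = {Suc k} \<times> {ls ! k - j + 1..ls ! k}"

definition arc_seg :: "nat \<Rightarrow> nat \<Rightarrow> (nat \<times> nat) set" where
  "arc_seg j a = {0} \<times> {a..<a + j}"

lemma weight_tip:
  assumes "k < length ls" "1 \<le> j" "j \<le> ls ! k"
  shows "tip j k \<subseteq> V - {hub}" "card (tip j k) = j" "\<beta> (tip j k) = 1" "\<beta> (V - tip j k) = of_nat (m - 1)"
proof -
  show sub: "tip j k \<subseteq> V - {hub}"
    using assms by (auto simp: tip_def std_verts_iff)
  show "card (tip j k) = j"
    using assms by (simp add: tip_def card_cartesian_product)
  have eq: "tip j k = {Suc k} \<times> {ls ! k - j + 1..(ls ! k - j + 1) + (j - 1)}"
    using assms by (simp add: tip_def)
  have "\<beta> ({Suc k} \<times> {ls ! k - j + 1..(ls ! k - j + 1) + (j - 1)}) = 1"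
    using sub eq by (intro linear_chromatic_interval) auto
  then show "\<beta> (tip j k) = 1"
    using eq by simp
  have "V - tip j k = {0} \<times> {..<m} \<union> arms ((\<lambda>k. ls ! k)(k := ls ! k - j))"
    using assms by (fastforce simp: V_eq_arms arms_def tip_def split: if_splits)
  then show "\<beta> (V - tip j k) = of_nat (m - 1)"
    using m by (simp add: linear_chromatic_arms linear_chromatic_whole_cycle)
qed

lemma weight_arc_seg:
  assumes "1 \<le> a" "1 \<le> j" "a + j \<le> m"
  shows "arc_seg j a \<subseteq> V - {hub}" "card (arc_seg j a) = j" "\<beta> (arc_seg j a) = 1" "\<beta> (V - arc_seg j a) = 1"
proof -
  show sub: "arc_seg j a \<subseteq> V - {hub}"
    using assms by (auto simp: arc_seg_def std_verts_iff)
  show "card (arc_seg j a) = j"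
    by (simp add: arc_seg_def card_cartesian_product)
  have eq: "arc_seg j a = {0} \<times> {a..a + (j - 1)}"
    using assms by (auto simp: arc_seg_def)
  have "\<beta> ({0} \<times> {a..a + (j - 1)}) = 1"
    using sub eq assms by (intro linear_chromatic_interval) auto
  then show "\<beta> (arc_seg j a) = 1"
    using eq by simp
  have "V - arc_seg j a = {0} \<times> ({..<a} \<union> {a + j..<m}) \<union> arms (\<lambda>k. ls ! k)"
    using assms by (auto simp: V_eq_arms arms_def arc_seg_def)
  moreover have "\<beta> ({0} \<times> ({..<a} \<union> {a + j..<m}) \<union> arms (\<lambda>k. ls ! k)) =
      \<beta> ({0} \<times> ({..<a} \<union> {a + j..<m}))"
    using assms by (intro linear_chromatic_arms) auto
  ultimately show "\<beta> (V - arc_seg j a) = 1"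
    using assms by (simp add: linear_chromatic_broken_cycle)
qed

end

section \<open>Splittings into a part with the hub and a part without it\<close>

definition count_ge :: "nat list \<Rightarrow> nat \<Rightarrow> nat" where
  "count_ge ls j = length (filter ((\<le>) j) ls)"

context squid_model
begin

text \<open>Removing the hub leaves disjoint paths, and a connected part of a path is an interval.
  On a tentacle the connectivity of the complement forces the interval to reach the end, since
  otherwise the vertices beyond it would be cut off from the hub. On the cycle both remaining sides
  stay attached to the hub.\<close>

lemma connected_splitD:
  assumes B: "B \<subseteq> V - {hub}" "B \<noteq> {}" and "\<beta> B \<noteq> 0" "\<beta> (V - B) \<noteq> 0"
  obtains (tip) k j where "k < length ls" "1 \<le> j" "j \<le> ls ! k" "B = tip j k"
  | (arc_seg) a j where "1 \<le> a" "1 \<le> j" "a + j \<le> m" "B = arc_seg j a"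
proof -
  have fin: "finite B"
    using B finite_std_verts finite_subset by blast
  obtain k i0 where ki: "(k, i0) \<in> B"
    using B by auto
  \<comment> \<open>Every arc between different first coordinates involves the hub, which is not in
    \<open>B\<close>.\<close>
  have arm: "fst x = k" if "x \<in> B" for x
  proof (rule ccontr)
    assume "fst x \<noteq> k"
    then have "\<exists>u\<in>{x \<in> B. fst x = k}. \<exists>w\<in>B - {x \<in> B. fst x = k}. (u, w) \<in> R"
      using that ki assms fin sym_std_arcs by (intro linear_chromatic_connected) auto
    then obtain u w where "u \<in> B" "w \<in> B" "fst u = k" "fst w \<noteq> k" "(u, w) \<in> R"
      by blast
    then show False
      using B(1) by (cases u; cases w) (auto simp: std_arcs_iff)
  qed
  define I where "I = snd ` B"
  have BI: "B = {k} \<times> I"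
    using arm by (force simp: I_def)
  have I: "finite I" "I \<noteq> {}"
    using fin ki by (auto simp: I_def)
  define a where "a = Min I"
  define b where "b = Max I"
  have ab: "a \<in> I" "b \<in> I" "I \<subseteq> {a..b}" "a \<le> b"
    using I by (auto simp: a_def b_def)
  \<comment> \<open>A missing position \<open>c\<close> would separate the positions below it from
    those above. The arc that closes the cycle cannot bridge the gap because it ends in the
    hub.\<close>
  have "c \<in> I" if c: "a \<le> c" "c \<le> b" for c
  proof (rule ccontr)
    assume cI: "c \<notin> I"
    have "\<exists>u\<in>{x \<in> B. snd x < c}. \<exists>w\<in>B - {x \<in> B. snd x < c}. (u, w) \<in> R"
    proof (rule linear_chromatic_connected)
      have "a < c"
        using ab(1) cI c by (metis le_neq_implies_less)
      moreover have "(k, a) \<in> B"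
        using BI ab(1) by simp
      ultimately show "{x \<in> B. snd x < c} \<noteq> {}"
        by force
      have "(k, b) \<in> B"
        using BI ab(2) by simp
      moreover have "(k, b) \<notin> {x \<in> B. snd x < c}"
        using c by simp
      ultimately show "{x \<in> B. snd x < c} \<noteq> B"
        by blast
    qed (use assms fin sym_std_arcs in auto)
    then obtain u w where "u \<in> B" "w \<in> B" "snd u < c" "\<not> snd w < c" "(u, w) \<in> R"
      by blast
    then obtain i i' where i: "i \<in> I" "i' \<in> I" "i < c" "c \<le> i'" "((k, i), (k, i')) \<in> R"
      unfolding BI by auto
    then have "(k, i) \<noteq> hub" "(k, i') \<noteq> hub" "i' \<noteq> c"
      using B BI cI by auto
    then show False
      using i by (auto simp: std_arcs_iff)
  qed
  then have BI': "B = {k} \<times> {a..b}"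
    using BI ab(3) by auto
  have aV: "(k, a) \<in> V" "(k, a) \<noteq> hub" and bV: "(k, b) \<in> V"
  proof -
    have "(k, a) \<in> B" "(k, b) \<in> B"
      using BI' ab(4) by simp_all
    then show "(k, a) \<in> V" "(k, a) \<noteq> hub" "(k, b) \<in> V"
      using B(1) by blast+
  qed
  show thesis
  proof (cases k)
    case 0
    show thesis
    proof (rule arc_seg)
      show "1 \<le> a" "1 \<le> b + 1 - a" "a + (b + 1 - a) \<le> m"
        using aV bV ab(4) 0 by (auto simp: std_verts_iff)
      show "B = arc_seg (b + 1 - a) a"
        using BI' ab(4) 0 by (auto simp: arc_seg_def)
    qed
  next
    case (Suc k')
    have k': "k' < length ls" "1 \<le> a" "b \<le> ls ! k'"
      using aV bV Suc by (auto simp: std_verts_iff)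
    have "b = ls ! k'"
    proof (rule ccontr)
      assume "b \<noteq> ls ! k'"
      then have b: "b < ls ! k'"
        using k' by simp
      let ?S = "{k} \<times> {b<..ls ! k'}"
      have "\<exists>u\<in>?S. \<exists>w\<in>(V - B) - ?S. (u, w) \<in> R"
      proof (rule linear_chromatic_connected)
        show "?S \<subseteq> V - B"
          using k' Suc BI' by (auto simp: std_verts_iff)
        show "?S \<noteq> V - B"
          using hub_in_V B Suc by auto
        show "?S \<noteq> {}"
          using b by auto
      qed (use assms finite_std_verts sym_std_arcs in auto)
      then obtain u w where uw: "u \<in> ?S" "w \<notin> B" "w \<notin> ?S" "(u, w) \<in> R"
        by blast
      obtain i k'' i'' where "u = (k, i)" "w = (k'', i'')"
        using uw(1) by (cases u; cases w) auto
      then have i: "b < i" "i \<le> ls ! k'" "((k, i), (k'', i'')) \<in> R"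
        "(k'', i'') \<notin> B" "(k'', i'') \<notin> ?S"
        using uw by auto
      have "i \<noteq> 1"
        using i(1) k'(2) ab(4) by simp
      then have "k'' = k" "i'' = Suc i \<or> i = Suc i''" "(k, i'') \<in> V"
        using i(3) Suc by (auto simp: std_arcs_iff)
      then have "i'' \<le> ls ! k'" "b \<le> i''"
        using i(1) Suc by (auto simp: std_verts_iff)
      then show False
        using i(4,5) \<open>k'' = k\<close> BI' ab(4) by (cases "i'' = b") auto
    qed
    show thesis
    proof (rule tip)
      show "k' < length ls" "1 \<le> b + 1 - a" "b + 1 - a \<le> ls ! k'"
        using k' ab(4) by auto
      show "B = tip (b + 1 - a) k'"
        using BI' Suc \<open>b = ls ! k'\<close> ab(4) k' by (simp add: tip_def)
    qed
  qed
qed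

definition hubless_weight :: "nat \<Rightarrow> rat" where
  "hubless_weight j = (\<Sum>B | B \<subseteq> V - {hub} \<and> card B = j. \<beta> B * \<beta> (V - B))"

text \<open>Without the hub the cycle is a path on \<open>m - 1\<close> vertices, with
  \<open>(m - 1) - j + 1 = m - j\<close> segments of \<open>j\<close> vertices; the truncated
  subtraction gives 0 when \<open>j\<close> is too large for a segment.\<close>

lemma hubless_weight_eq:
  assumes j: "1 \<le> j"
  shows "hubless_weight j = of_nat ((m - 1) * count_ge ls j + (m - j))"
proof -
  let ?K = "{k. k < length ls \<and> j \<le> ls ! k}"
  let ?A = "{a. 1 \<le> a \<and> a + j \<le> m}"
  let ?w = "\<lambda>B. \<beta> B * \<beta> (V - B)"
  have "?A = {1..m - j}"
    using j by auto
  then have A: "finite ?A" "card ?A = m - j"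
    by simp_all
  have "hubless_weight j = sum ?w (tip j ` ?K \<union> arc_seg j ` ?A)"
    unfolding hubless_weight_def
  proof (rule sum.mono_neutral_right)
    show "finite {B. B \<subseteq> V - {hub} \<and> card B = j}"
      using finite_std_verts by simp
    show "tip j ` ?K \<union> arc_seg j ` ?A \<subseteq> {B. B \<subseteq> V - {hub} \<and> card B = j}"
      using weight_tip(1,2) weight_arc_seg(1,2) j by blast
    show "\<forall>B\<in>{B. B \<subseteq> V - {hub} \<and> card B = j} - (tip j ` ?K \<union> arc_seg j ` ?A). ?w B = 0"
    proof (rule ballI, rule ccontr)
      fix B assume B: "B \<in> {B. B \<subseteq> V - {hub} \<and> card B = j} - (tip j ` ?K \<union> arc_seg j ` ?A)"
        and "?w B \<noteq> 0"
      then have "B \<subseteq> V - {hub}" "B \<noteq> {}" "\<beta> B \<noteq> 0" "\<beta> (V - B) \<noteq> 0" "card B = j"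
        using j by auto
      from this(1-4) show False
      proof (cases rule: connected_splitD)
        case (tip k j')
        then have "j' = j"
          using weight_tip(2) \<open>card B = j\<close> by auto
        then show False
          using tip B by auto
      next
        case (arc_seg a j')
        then have "j' = j"
          using weight_arc_seg(2) \<open>card B = j\<close> by auto
        then show False
          using arc_seg B by auto
      qed
    qed
  qed
  also have "\<dots> = sum ?w (tip j ` ?K) + sum ?w (arc_seg j ` ?A)"
  proof (rule sum.union_disjoint)
    have "tip j k \<noteq> arc_seg j a" for k a
    proof -
      have "(0, a) \<in> arc_seg j a" "(0, a) \<notin> tip j k"
        using j by (auto simp: tip_def arc_seg_def)
      then show ?thesis by metis
    qed
    then show "tip j ` ?K \<inter> arc_seg j ` ?A = {}"
      by blast
  qed (use A in auto)
  also have "sum ?w (tip j ` ?K) = (\<Sum>k\<in>?K. ?w (tip j k))"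
  proof (rule sum.reindex_cong[OF _ refl refl], rule inj_onI)
    fix k k' assume k: "k \<in> ?K" and eq: "tip j k = tip j k'"
    have "(Suc k, ls ! k) \<in> tip j k"
      using j k by (auto simp: tip_def)
    then have "(Suc k, ls ! k) \<in> tip j k'"
      by (simp only: eq)
    then show "k = k'"
      by (simp add: tip_def)
  qed
  also have "\<dots> = (\<Sum>k\<in>?K. of_nat (m - 1))"
    using j by (intro sum.cong) (auto simp: weight_tip)
  also have "\<dots> = of_nat ((m - 1) * count_ge ls j)"
    by (simp add: count_ge_def length_filter_conv_card mult.commute)
  also have "sum ?w (arc_seg j ` ?A) = (\<Sum>a\<in>?A. ?w (arc_seg j a))"
  proof (rule sum.reindex_cong[OF _ refl refl], rule inj_onI)
    fix a a' assume eq: "arc_seg j a = arc_seg j a'"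
    have "(0, a) \<in> arc_seg j a" "(0, a') \<in> arc_seg j a'"
      using j by (auto simp: arc_seg_def)
    then have "(0, a) \<in> arc_seg j a'" "(0, a') \<in> arc_seg j a"
      using eq by simp_all
    then show "a = a'"
      by (simp add: arc_seg_def)
  qed
  also have "\<dots> = (\<Sum>a\<in>?A. 1)"
    using j by (intro sum.cong) (auto simp: weight_arc_seg)
  also have "\<dots> = of_nat (m - j)"
    using A by simp
  finally show ?thesis
    by simp
qed

text \<open>Exactly one part of a splitting avoids the hub. If it is not the part of size
  \<open>j\<close>, it is the complement, of size \<open>card V - j\<close>.\<close>

lemma split_weight_hubless:
  assumes "j \<le> card V"
  shows "split_weight R V j = hubless_weight j + hubless_weight (card V - j)"
proof -
  let ?w = "\<lambda>B. \<beta> B * \<beta> (V - B)"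
  let ?N = "{B. B \<subseteq> V - {hub} \<and> card B = j}"
  let ?H = "{B. B \<subseteq> V \<and> hub \<in> B \<and> card B = j}"
  let ?N' = "{B. B \<subseteq> V - {hub} \<and> card B = card V - j}"
  have "{A. A \<subseteq> V \<and> card A = j} = ?N \<union> ?H"
    by auto
  then have "split_weight R V j = sum ?w (?N \<union> ?H)"
    by (simp add: split_weight_def)
  also have "\<dots> = sum ?w ?N + sum ?w ?H"
    using finite_std_verts by (intro sum.union_disjoint) auto
  also have "sum ?w ?H = sum ?w ?N'"
  proof (rule sum.reindex_bij_witness[where i = "\<lambda>B. V - B" and j = "\<lambda>B. V - B"])
    fix B assume B: "B \<in> ?H"
    then have "finite B"
      using finite_std_verts finite_subset by blast
    then show "V - (V - B) = B" "V - B \<in> ?N'" "\<beta> (V - B) * \<beta> (V - (V - B)) = \<beta> B * \<beta> (V - B)"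
      using B by (auto simp: double_diff card_Diff_subset)
  next
    fix B assume B: "B \<in> ?N'"
    then have sub: "B \<subseteq> V" and "finite B"
      using finite_std_verts finite_subset by blast+
    then show "V - (V - B) = B" "V - B \<in> ?H"
      using B hub_in_V assms by (auto simp: double_diff card_Diff_subset)
  qed
  finally show ?thesis
    by (simp add: hubless_weight_def)
qed

end

section \<open>Tentacle lengths from symmetrized counts\<close>

lemma count_ge_antimono: "i \<le> j \<Longrightarrow> count_ge ls j \<le> count_ge ls i"
  by (induction ls) (auto simp: count_ge_def)

lemma count_ge_mult_le: "j * count_ge ls j \<le> sum_list ls"
  by (induction ls) (auto simp: count_ge_def)

text \<open>Two different entries contribute to the sum: one that is at least \<open>b\<close>, and
  another that is at least \<open>a\<close>, which exists because there are two entries of that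
  size.\<close>

lemma count_ge_sum_list:
  assumes "a \<le> b" "1 \<le> count_ge ls b" "2 \<le> count_ge ls a"
  shows "a + b \<le> sum_list ls"
  using assms
proof (induction ls)
  case (Cons l ls)
  consider "b \<le> l" | "\<not> b \<le> l" "a \<le> l" | "\<not> a \<le> l"
    by blast
  then show ?case
  proof cases
    case 1
    then have "1 \<le> count_ge ls a"
      using Cons.prems by (auto simp: count_ge_def)
    then have "a * 1 \<le> sum_list ls"
      using count_ge_mult_le[of a ls] mult_le_mono2 order.trans by blast
    then show ?thesis using 1 by simp
  next
    case 2
    then have "1 \<le> count_ge ls b"
      using Cons.prems by (auto simp: count_ge_def)
    then have "b * 1 \<le> sum_list ls"
      using count_ge_mult_le[of b ls] mult_le_mono2 order.trans by blast
    then show ?thesis using 2 by simp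
  next
    case 3
    then show ?thesis
      using Cons by (auto simp: count_ge_def)
  qed
qed (simp add: count_ge_def)

lemma count_ge_eq_0_iff: "count_ge ls j = 0 \<longleftrightarrow> (\<forall>l\<in>set ls. l < j)"
  by (auto simp: count_ge_def filter_empty_conv not_le)

text \<open>If some tentacle is longer than \<open>n / 2\<close>, its length \<open>L\<close> is visible in the symmetrized counts
  as the place where they increase from 1 at \<open>n - L - 1\<close> to 2 at \<open>n - L\<close>.\<close>

lemma long_tentacle_eq:
  assumes sums: "sum_list ls + 3 \<le> n" "sum_list ls' + 3 \<le> n"
    and eq: "\<And>j. 1 \<le> j \<Longrightarrow> j < n \<Longrightarrow>
      count_ge ls j + count_ge ls (n - j) = count_ge ls' j + count_ge ls' (n - j)"
    and long: "l0 \<in> set ls" "n < 2 * l0" and j: "n \<le> 2 * j"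
  shows "count_ge ls j = count_ge ls' j"
proof -
  define L where "L = Max (set ls)"
  have ne: "set ls \<noteq> {}" using long by auto
  have L: "L \<in> set ls" "\<And>l. l \<in> set ls \<Longrightarrow> l \<le> L"
    using ne by (auto simp: L_def)
  have nL: "n < 2 * L" using L(2)[OF long(1)] long(2) by simp
  have Ln: "L + 3 \<le> n"
    using member_le_sum_list[OF L(1)] sums(1) by simp
  have t1: "1 \<le> count_ge ls L"
    using L(1) count_ge_eq_0_iff[of ls L] by (metis less_irrefl not_less_eq_eq One_nat_def le_0_eq)
  have t0: "count_ge ls (L + 1) = 0"
    using L(2) by (simp add: count_ge_eq_0_iff less_Suc_eq_le)
  \<comment> \<open>A second tentacle of length at least \<open>n - L - 1\<close> would bring the
    total to at least \<open>n - 1\<close>, but it is at most \<open>n - 3\<close>.\<close>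
  have one: "count_ge ls (n - L - 1) < 2"
  proof (rule ccontr)
    assume "\<not> ?thesis"
    then have "n - L - 1 + L \<le> sum_list ls"
      using t1 nL by (intro count_ge_sum_list) auto
    then show False using sums(1) Ln by simp
  qed
  have mono: "count_ge xs b \<le> count_ge xs a" if "a \<le> b" for xs a b
    using that by (rule count_ge_antimono)
  have u1: "count_ge ls L \<le> count_ge ls (n - L)" "count_ge ls (n - L) \<le> count_ge ls (n - L - 1)"
    using nL by (auto intro!: mono)
  have u2: "count_ge ls' L \<le> count_ge ls' (n - L)" "count_ge ls' (n - L) \<le> count_ge ls' (n - L - 1)"
    using nL by (auto intro!: mono)
  have e1: "count_ge ls (n - L - 1) + count_ge ls (L + 1) =
      count_ge ls' (n - L - 1) + count_ge ls' (L + 1)"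
    using eq[of "n - L - 1"] Ln by (simp add: Suc_diff_le)
  have e2: "count_ge ls (n - L) + count_ge ls L = count_ge ls' (n - L) + count_ge ls' L"
    using eq[of "n - L"] Ln nL by simp
  \<comment> \<open>For \<open>ls\<close> the counts at \<open>L\<close>, \<open>n - L\<close> and
    \<open>n - L - 1\<close> are squeezed to 1, so the sums in \<open>e1\<close> and
    \<open>e2\<close> are 1 and 2. For \<open>ls'\<close>, \<open>e1\<close> and monotonicity bound
    both terms in \<open>e2\<close> by 1, so both equal 1, and then \<open>e1\<close> leaves 0 at
    \<open>L + 1\<close>.\<close>
  have v: "count_ge ls L = 1" "count_ge ls (n - L) = 1" "count_ge ls' L = 1"
    "count_ge ls' (n - L) = 1" "count_ge ls' (L + 1) = 0"
    using t1 t0 one u1 u2 e1 e2 by linarith+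
  show ?thesis
  proof (cases "j \<le> L")
    case True
    have "n - L \<le> j" using j nL by simp
    then show ?thesis
      using mono[OF True, of ls] mono[OF True, of ls'] mono[of "n - L" j ls] mono[of "n - L" j ls'] v
      by simp
  next
    case False
    then have "L + 1 \<le> j" by simp
    then show ?thesis
      using mono[of "L + 1" j ls] mono[of "L + 1" j ls'] v t0 by simp
  qed
qed

text \<open>The counts above \<open>n / 2\<close> come first: if one of the lists has an entry above
  \<open>n / 2\<close>, \<open>long_tentacle_eq\<close> applies, possibly with the roles exchanged,
  and otherwise these counts are all 0. The sums then yield the counts below \<open>n / 2\<close>;
  for \<open>2 * j = n\<close> the sum is twice the count.\<close>

lemma count_ge_determined:
  assumes sums: "sum_list ls + 3 \<le> n" "sum_list ls' + 3 \<le> n"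
    and eq: "\<And>j. 1 \<le> j \<Longrightarrow> j < n \<Longrightarrow>
      count_ge ls j + count_ge ls (n - j) = count_ge ls' j + count_ge ls' (n - j)"
    and j: "1 \<le> j"
  shows "count_ge ls j = count_ge ls' j"
proof -
  have upper: "count_ge ls j = count_ge ls' j" if "n < 2 * j" for j
  proof (cases "\<exists>l\<in>set ls. n < 2 * l")
    case True
    then show ?thesis
      using long_tentacle_eq[OF sums eq] that by auto
  next
    case F: False
    show ?thesis
    proof (cases "\<exists>l\<in>set ls'. n < 2 * l")
      case True
      then show ?thesis
        using long_tentacle_eq[OF sums(2,1) eq[symmetric]] that by auto
    next
      case False
      then have "count_ge ls j = 0" "count_ge ls' j = 0"
        using F that by (fastforce simp: count_ge_eq_0_iff)+
      then show ?thesis by simp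
    qed
  qed
  consider "n < 2 * j" | "n = 2 * j" | "2 * j < n" by linarith
  then show ?thesis
  proof cases
    case 1
    then show ?thesis by (rule upper)
  next
    case 2
    then show ?thesis using eq[of j] j by simp
  next
    case 3
    then show ?thesis using eq[of j] j upper[of "n - j"] by simp
  qed
qed

text \<open>The multiplicity of \<open>l\<close> is the drop of the count from \<open>l\<close> to
  \<open>l + 1\<close>. Positivity of the entries settles \<open>l = 0\<close>, as the counts are
  compared from 1 on only.\<close>

lemma mset_eq_if_count_ge_eq:
  assumes "\<And>l. l \<in> set ls \<union> set ls' \<Longrightarrow> 1 \<le> l"
    and eq: "\<And>j. 1 \<le> j \<Longrightarrow> count_ge ls j = count_ge ls' j"
  shows "mset ls = mset ls'"
proof (rule multiset_eqI)
  fix l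
  have count: "count (mset xs) l + count_ge xs (Suc l) = count_ge xs l" for xs
    by (induction xs) (auto simp: count_ge_def)
  show "count (mset ls) l = count (mset ls') l"
  proof (cases "1 \<le> l")
    case True
    then show ?thesis
      using count[of ls] count[of ls'] eq[of l] eq[of "Suc l"] by simp
  next
    case False
    then have "l \<notin> set ls" "l \<notin> set ls'"
      using assms(1) by blast+
    then have "count (mset ls) l = 0" "count (mset ls') l = 0"
      by (simp_all add: count_eq_zero_iff)
    then show ?thesis by (simp only:)
  qed
qed

lemma std_squid_determined:
  assumes "squid_model m ls" "squid_model m' ls'"
    and "chromatic_symmetric_function (std_squid m ls) = chromatic_symmetric_function (std_squid m' ls')"
  shows "m = m'" "mset ls = mset ls'"
proof -
  interpret A: squid_model m ls by fact
  interpret B: squid_model m' ls' by fact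
  interpret same_chromatic "std_squid m ls" "std_squid m' ls'"
    using assms(3) A.m B.m by (intro same_chromatic.intro pair_graph_std_squid) auto
  have [simp]: "pverts (std_squid m ls) = std_verts m ls" "parcs (std_squid m ls) = std_arcs m ls" for m ls
    by (simp_all add: std_squid_def)
  have "m - 1 = m' - 1"
    using same_linear_chromatic A.linear_chromatic_V B.linear_chromatic_V by simp
  then show mm: "m = m'"
    using A.m B.m by simp
  define n where "n = card (std_verts m ls)"
  have n: "card (std_verts m' ls') = n"
    using same_card_verts by (simp add: n_def)
  have eq: "count_ge ls j + count_ge ls (n - j) = count_ge ls' j + count_ge ls' (n - j)"
    if j: "1 \<le> j" "j < n" for j
  proof -
    have "split_weight (std_arcs m ls) (std_verts m ls) j =
        split_weight (std_arcs m' ls') (std_verts m' ls') j"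
      using same_split_weight[of j] by simp
    then have "(m - 1) * count_ge ls j + (m - j) + ((m - 1) * count_ge ls (n - j) + (m - (n - j))) =
        (m' - 1) * count_ge ls' j + (m' - j) + ((m' - 1) * count_ge ls' (n - j) + (m' - (n - j)))"
      using j n A.split_weight_hubless[of j] B.split_weight_hubless[of j]
      by (simp add: A.hubless_weight_eq B.hubless_weight_eq n_def[symmetric] del: of_nat_add flip: of_nat_add)
    \<comment> \<open>As \<open>m\<close> is already known, the contributions of the cycle segments
      agree and cancel. The factor \<open>m - 1\<close> is positive.\<close>
    then have "(m - 1) * (count_ge ls j + count_ge ls (n - j)) =
        (m - 1) * (count_ge ls' j + count_ge ls' (n - j))"
      by (simp add: mm algebra_simps)
    then show ?thesis
      using A.m by simp
  qed
  show "mset ls = mset ls'"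
  proof (rule mset_eq_if_count_ge_eq)
    fix j :: nat assume "1 \<le> j"
    then show "count_ge ls j = count_ge ls' j"
      using A.m B.m n eq by (intro count_ge_determined[of ls n ls' j]) (auto simp: card_std_verts n_def)
  qed (use A.ls B.ls in auto)
qed

section \<open>Coordinates on a squid\<close>

text \<open>The vertices are \<open>c 0\<close>, ..., \<open>c n\<close>, so the length is
  \<open>n + 1\<close>, and \<open>2 \<le> n\<close> excludes traversing one edge back and
  forth.\<close>

definition cycle_on :: "'a rel \<Rightarrow> (nat \<Rightarrow> 'a) \<Rightarrow> nat \<Rightarrow> bool" where
  "cycle_on R c n \<longleftrightarrow> 2 \<le> n \<and> inj_on c {..n} \<and> (\<forall>i<n. (c i, c (Suc i)) \<in> R) \<and> (c n, c 0) \<in> R"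

lemma cycle_on_rotate:
  assumes c: "cycle_on R c n" and k: "k \<le> n"
  obtains c' where "cycle_on R c' n" "c' 0 = c k"
proof -
  define c' where "c' i = (if i + k \<le> n then c (i + k) else c (i + k - Suc n))" for i
  have n: "2 \<le> n" and inj: "inj_on c {..n}" and adj: "\<And>i. i < n \<Longrightarrow> (c i, c (Suc i)) \<in> R"
    and last: "(c n, c 0) \<in> R"
    using c by (auto simp: cycle_on_def)
  have "inj_on c' {..n}"
  proof (rule inj_onI)
    fix i j assume ij: "i \<in> {..n}" "j \<in> {..n}" "c' i = c' j"
    have "(if i + k \<le> n then i + k else i + k - Suc n) = (if j + k \<le> n then j + k else j + k - Suc n)"
      using ij k by (intro inj_onD[OF inj]) (auto simp: c'_def split: if_splits)
    then show "i = j"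
      using ij k by (auto split: if_splits)
  qed
  moreover have "(c' i, c' (Suc i)) \<in> R" if "i < n" for i
  proof -
    consider "Suc i + k \<le> n" | "i + k = n" | "n < i + k" by linarith
    then show ?thesis
    proof cases
      case 1
      then show ?thesis using adj[of "i + k"] by (simp add: c'_def)
    next
      case 2
      then show ?thesis using last by (simp add: c'_def)
    next
      case 3
      then have "Suc (i + k - Suc n) = i + k - n" by simp
      then show ?thesis using adj[of "i + k - Suc n"] 3 that k by (simp add: c'_def)
    qed
  qed
  moreover have "(c' n, c' 0) \<in> R"
  proof (cases "k = 0")
    case True
    then show ?thesis using last by (simp add: c'_def)
  next
    case False
    then show ?thesis using adj[of "k - 1"] k by (simp add: c'_def)
  qed
  ultimately have "cycle_on R c' n"
    using n by (simp add: cycle_on_def)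
  moreover have "c' 0 = c k"
    using k by (simp add: c'_def)
  ultimately show ?thesis by (rule that)
qed

text \<open>What the construction of coordinates needs, detached from walks: connectivity says that
  no proper nonempty set of vertices is closed under adjacency, and the uniqueness of the cycle is
  stated for vertex sets.\<close>

locale hub_graph =
  fixes V :: "'a set" and R :: "'a rel" and v :: 'a
  assumes fin: "finite V" and RV: "R \<subseteq> V \<times> V" and sym: "sym R" and irr: "\<And>x. (x, x) \<notin> R"
    and conn: "\<And>S. S \<subseteq> V \<Longrightarrow> S \<noteq> {} \<Longrightarrow> (\<And>x y. x \<in> S \<Longrightarrow> (x, y) \<in> R \<Longrightarrow> y \<in> S) \<Longrightarrow> S = V"
    and hub: "v \<in> V" and deg: "\<And>x. x \<in> V \<Longrightarrow> x \<noteq> v \<Longrightarrow> card (R `` {x}) \<le> 2"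
    and ex_cycle: "\<exists>c n. cycle_on R c n"
    and unique_cycle: "\<And>c n c' n'. cycle_on R c n \<Longrightarrow> cycle_on R c' n' \<Longrightarrow> c ` {..n} = c' ` {..n'}"
begin

lemma symR: "(x, y) \<in> R \<longleftrightarrow> (y, x) \<in> R"
  using sym unfolding sym_def by blast

lemma nbrs_eq:
  assumes "x \<noteq> v" "a \<noteq> b" "(x, a) \<in> R" "(x, b) \<in> R"
  shows "R `` {x} = {a, b}"
proof (rule card_seteq[symmetric])
  have "R `` {x} \<subseteq> V" using RV by auto
  then show "finite (R `` {x})" using fin finite_subset by blast
  show "card (R `` {x}) \<le> card {a, b}"
    using deg[of x] assms RV by auto
qed (use assms in auto)

lemma cycle_nbrs:
  assumes c: "cycle_on R c n" and i: "i \<le> n" "c i \<noteq> v"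
  shows "R `` {c i} = {c (if i = 0 then n else i - 1), c (if i = n then 0 else Suc i)}"
proof (rule nbrs_eq[OF i(2)])
  have n: "2 \<le> n" and inj: "inj_on c {..n}" and adj: "\<And>i. i < n \<Longrightarrow> (c i, c (Suc i)) \<in> R"
    and last: "(c n, c 0) \<in> R"
    using c by (auto simp: cycle_on_def)
  show "c (if i = 0 then n else i - 1) \<noteq> c (if i = n then 0 else Suc i)"
    using n i by (subst inj_on_eq_iff[OF inj]) auto
  show "(c i, c (if i = 0 then n else i - 1)) \<in> R"
    using last adj[of "i - 1"] i by (auto simp: symR)
  show "(c i, c (if i = n then 0 else Suc i)) \<in> R"
    using last adj[of i] i by auto
qed

lemma cycle_subset:
  assumes "cycle_on R c n"
  shows "c ` {..n} \<subseteq> V"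
proof (intro image_subsetI)
  fix i assume "i \<in> {..n}"
  then have "(c i, c (if i = n then 0 else Suc i)) \<in> R"
    using assms by (auto simp: cycle_on_def)
  then show "c i \<in> V"
    using RV by auto
qed

text \<open>On a cycle without the hub all degrees are at most 2, so it would be closed under
  adjacency and, by connectivity, be the whole graph.\<close>

lemma hub_on_cycle:
  assumes c: "cycle_on R c n"
  shows "v \<in> c ` {..n}"
proof (rule ccontr)
  assume v: "v \<notin> c ` {..n}"
  have "c ` {..n} = V"
  proof (rule conn)
    fix x y assume "x \<in> c ` {..n}" "(x, y) \<in> R"
    then obtain i where i: "i \<le> n" "x = c i" by auto
    then have "R `` {x} = {c (if i = 0 then n else i - 1), c (if i = n then 0 else Suc i)}"
      using cycle_nbrs[OF c i(1)] v by (metis atMost_iff imageI)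
    then have "R `` {x} \<subseteq> c ` {..n}"
      using i by auto
    then show "y \<in> c ` {..n}"
      using \<open>(x, y) \<in> R\<close> by auto
  qed (use cycle_subset[OF c] in auto)
  then show False
    using v hub by simp
qed

text \<open>Position 0 is the hub, which matches the numbering of tentacles in the model. An arm
  need not be maximal.\<close>

definition arm :: "'a \<Rightarrow> nat \<Rightarrow> (nat \<Rightarrow> 'a) \<Rightarrow> bool" where
  "arm u l p \<longleftrightarrow> 1 \<le> l \<and> p 0 = v \<and> p 1 = u \<and> inj_on p {..l} \<and> (\<forall>i<l. (p i, p (Suc i)) \<in> R)"

lemma arm_not_hub: "arm u l p \<Longrightarrow> 1 \<le> i \<Longrightarrow> i \<le> l \<Longrightarrow> p i \<noteq> v"
  unfolding arm_def inj_on_def by (metis atMost_iff not_one_le_zero zero_le)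

lemma arm_nbrs:
  assumes p: "arm u l p" and i: "1 \<le> i" "i < l"
  shows "R `` {p i} = {p (i - 1), p (Suc i)}"
proof (rule nbrs_eq)
  show "p i \<noteq> v" using arm_not_hub[OF p] i by simp
  show "p (i - 1) \<noteq> p (Suc i)"
    using p i inj_on_eq_iff[of p "{..l}" "i - 1" "Suc i"] by (simp add: arm_def)
  have "(p (i - 1), p (Suc (i - 1))) \<in> R" using p i unfolding arm_def by (meson diff_le_self le_less_trans)
  then show "(p i, p (i - 1)) \<in> R" using i by (simp add: symR)
  show "(p i, p (Suc i)) \<in> R" using p i by (simp add: arm_def)
qed

text \<open>Take a longest arm. A further neighbor of its last vertex would extend it, or be the hub
  and close a cycle through \<open>u\<close>, which is not on the only cycle, or be an inner vertex
  that already has two other neighbors.\<close>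

lemma ex_full_arm:
  assumes c: "cycle_on R c n" and u: "(v, u) \<in> R" "u \<notin> c ` {..n}"
  shows "\<exists>l p. arm u l p \<and> R `` {p l} = {p (l - 1)}"
proof -
  have bound: "l \<le> card V" if "arm u l p" for l p
  proof -
    have "p i \<in> V" if "i \<le> l" for i
    proof (cases i)
      case 0
      then show ?thesis using \<open>arm u l p\<close> hub by (simp add: arm_def)
    next
      case (Suc k)
      then have "(p k, p i) \<in> R" using \<open>arm u l p\<close> \<open>i \<le> l\<close> by (simp add: arm_def)
      then show ?thesis using RV by auto
    qed
    then have "card (p ` {..l}) \<le> card V"
      using fin by (intro card_mono) auto
    then show ?thesis
      using that by (simp add: arm_def card_image)
  qed
  have "arm u 1 (\<lambda>i. if i = 0 then v else u)"
    using u irr by (auto simp: arm_def inj_on_def)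
  then have ex: "\<exists>p. arm u 1 p" by blast
  have bound': "\<forall>l. (\<exists>p. arm u l p) \<longrightarrow> l \<le> card V"
    using bound by blast
  define l where "l = (GREATEST l. \<exists>p. arm u l p)"
  obtain p where p: "arm u l p"
    using GreatestI_nat[where P = "\<lambda>l. \<exists>p. arm u l p", OF ex] bound' unfolding l_def by blast
  have max: "l' \<le> l" if "arm u l' p'" for l' p'
    using Greatest_le_nat[where P = "\<lambda>l. \<exists>p. arm u l p" and b = "card V" and k = l'] that bound'
    unfolding l_def by blast
  have "p (l - 1) \<in> R `` {p l}"
  proof -
    have l: "l - 1 < l" "Suc (l - 1) = l"
      using p by (auto simp: arm_def)
    then have "(p (l - 1), p (Suc (l - 1))) \<in> R"
      using p unfolding arm_def by blast
    then have "(p l, p (l - 1)) \<in> R"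
      using l symR by simp
    then show ?thesis by blast
  qed
  moreover have "y = p (l - 1)" if y: "(p l, y) \<in> R" for y
  proof (rule ccontr)
    assume ne: "y \<noteq> p (l - 1)"
    show False
    proof (cases "y \<in> p ` {..l}")
      case False
      have "arm u (Suc l) (p(Suc l := y))"
      proof -
        have "inj_on (p(Suc l := y)) {..Suc l}"
          using p False by (simp add: arm_def atMost_Suc inj_on_fun_updI)
        then show ?thesis
          using p y by (auto simp: arm_def less_Suc_eq)
      qed
      then show False
        using max[of "Suc l"] by force
    next
      case True
      then obtain i where i: "i \<le> l" "y = p i" by auto
      have "i \<noteq> l" "i \<noteq> l - 1"
        using i y ne irr by auto
      then have il: "Suc i < l"
        using i by simp
      show False
      proof (cases "i = 0")
        case True
        then have "cycle_on R p l"
          using p y i il by (auto simp: arm_def cycle_on_def)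
        then have "p ` {..l} = c ` {..n}"
          using unique_cycle c by blast
        moreover have "u \<in> p ` {..l}"
          using p unfolding arm_def by (metis atMost_iff imageI)
        ultimately show False
          using u by simp
      next
        case False
        then have "R `` {p i} = {p (i - 1), p (Suc i)}"
          using arm_nbrs[OF p, of i] il by simp
        moreover have "(p i, p l) \<in> R"
          using y i(2) symR by blast
        ultimately have "p l = p (i - 1) \<or> p l = p (Suc i)"
          by blast
        moreover have "inj_on p {..l}"
          using p by (simp add: arm_def)
        ultimately show False
          using il by (auto simp: inj_on_eq_iff)
      qed
    qed
  qed
  ultimately have "R `` {p l} = {p (l - 1)}"
    by blast
  then show ?thesis
    using p by blast
qed

text \<open>The way back along the arm meets no hub before \<open>u\<close>, so closure under
  neighbors other than the hub suffices. \<open>S\<close> will be the cycle without the hub or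
  another arm without the hub.\<close>

lemma arm_reaches_start:
  assumes p: "arm u l p" and S: "\<And>x y. x \<in> S \<Longrightarrow> (x, y) \<in> R \<Longrightarrow> y \<noteq> v \<Longrightarrow> y \<in> S"
    and i: "Suc i \<le> l" "p (Suc i) \<in> S"
  shows "u \<in> S"
  using i
proof (induction i)
  case 0
  then show ?case using p by (simp add: arm_def)
next
  case (Suc i)
  have "(p (Suc (Suc i)), p (Suc i)) \<in> R"
    using p Suc.prems by (simp add: arm_def symR)
  then have "p (Suc i) \<in> S"
    using S Suc.prems arm_not_hub[OF p, of "Suc i"] by simp
  then show ?case
    using Suc by simp
qed

lemma ex_std_coordinates:
  "\<exists>m ls f. squid_model m ls \<and> sorted ls \<and> bij_betw f (std_verts m ls) V \<and>
    (\<forall>x\<in>std_verts m ls. \<forall>y\<in>std_verts m ls. (x, y) \<in> std_arcs m ls \<longleftrightarrow> (f x, f y) \<in> R)"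
proof -
  obtain c0 n where c0: "cycle_on R c0 n"
    using ex_cycle by blast
  obtain k where k: "k \<le> n" "c0 k = v"
    using hub_on_cycle[OF c0] by auto
  obtain c where c: "cycle_on R c n" and c_hub: "c 0 = v"
    using cycle_on_rotate[OF c0 k(1)] k(2) by metis
  have n: "2 \<le> n" and c_inj: "inj_on c {..n}" and c_adj: "\<And>i. i < n \<Longrightarrow> (c i, c (Suc i)) \<in> R"
    and c_last: "(c n, c 0) \<in> R"
    using c by (auto simp: cycle_on_def)
  have c_ne: "c i \<noteq> v" if "1 \<le> i" "i \<le> n" for i
    using that inj_on_eq_iff[OF c_inj, of i 0] c_hub by auto
  have c_nbrs: "R `` {c i} = {c (i - 1), c (if i = n then 0 else Suc i)}" if "1 \<le> i" "i \<le> n" for i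
    using cycle_nbrs[OF c that(2) c_ne[OF that]] that by simp
  define N where "N = R `` {v} - c ` {..n}"
  have finN: "finite N"
    using RV fin finite_subset[of N V] by (auto simp: N_def)
  have "\<forall>u\<in>N. \<exists>lp. arm u (fst lp) (snd lp) \<and> R `` {snd lp (fst lp)} = {snd lp (fst lp - 1)}"
    using ex_full_arm[OF c] by (simp add: N_def)
  then obtain lp where lp: "\<forall>u\<in>N. arm u (fst (lp u)) (snd (lp u)) \<and>
      R `` {snd (lp u) (fst (lp u))} = {snd (lp u) (fst (lp u) - 1)}"
    by (rule bchoice[THEN exE])
  define L where "L u = fst (lp u)" for u
  define p where "p u = snd (lp u)" for u
  have p: "arm u (L u) (p u)" "R `` {p u (L u)} = {p u (L u - 1)}" if "u \<in> N" for u
    using lp that by (auto simp: L_def p_def)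
  have p_inj: "inj_on (p u) {..L u}" and L_pos: "1 \<le> L u" and p0: "p u 0 = v" and p1: "p u 1 = u"
    if "u \<in> N" for u
    using p(1)[OF that] by (auto simp: arm_def)
  have p_nbrs: "R `` {p u i} = {p u (i - 1)} \<union> (if i < L u then {p u (Suc i)} else {})"
    if "u \<in> N" "1 \<le> i" "i \<le> L u" for u i
    using arm_nbrs[OF p(1)[OF that(1)] that(2)] p(2)[OF that(1)] that by (cases "i = L u") auto
  have p_ne: "p u i \<noteq> v" if "u \<in> N" "1 \<le> i" "i \<le> L u" for u i
    using arm_not_hub[OF p(1)[OF that(1)]] that by simp
  \<comment> \<open>The cycle without the hub is closed under neighbors other than the hub, so an
    arm that meets it would start on it, against the choice of \<open>N\<close>.\<close>
  have p_off_cycle: "p u i \<notin> c ` {..n}" if u: "u \<in> N" and i: "1 \<le> i" "i \<le> L u" for u i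
  proof
    assume mem: "p u i \<in> c ` {..n}"
    have "u \<in> c ` {1..n}"
    proof (rule arm_reaches_start[OF p(1)[OF u]])
      show "Suc (i - 1) \<le> L u" using i by simp
      obtain i' where i': "i' \<le> n" "p u i = c i'" using mem by auto
      then have "i' \<noteq> 0" using p_ne[OF u i] c_hub by metis
      then show "p u (Suc (i - 1)) \<in> c ` {1..n}" using i i' by auto
      fix x y assume "x \<in> c ` {1..n}" "(x, y) \<in> R" and yv: "y \<noteq> v"
      then obtain j where j: "1 \<le> j" "j \<le> n" "(c j, y) \<in> R" by auto
      then have "y = c (j - 1) \<or> y = c (if j = n then 0 else Suc j)"
        using c_nbrs[OF j(1,2)] by blast
      moreover have "j - 1 \<le> n" "(if j = n then 0 else Suc j) \<le> n" using j(2) by auto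
      ultimately obtain j' where j': "y = c j'" "j' \<le> n" by blast
      moreover have "j' \<noteq> 0" using j'(1) yv c_hub by metis
      ultimately show "y \<in> c ` {1..n}" by auto
    qed
    then show False using u by (auto simp: N_def)
  qed
  \<comment> \<open>By the same argument \<open>u\<close> lies on the arm of \<open>u'\<close>.
    Being adjacent to the hub, it must be the first vertex there, which is
    \<open>u'\<close>.\<close>
  have p_disj: "u = u'" if u: "u \<in> N" "u' \<in> N" and i: "1 \<le> i" "i \<le> L u" "1 \<le> i'" "i' \<le> L u'"
    and eq: "p u i = p u' i'" for u u' i i'
  proof -
    have "u \<in> p u' ` {1..L u'}"
    proof (rule arm_reaches_start[OF p(1)[OF u(1)]])
      show "Suc (i - 1) \<le> L u" using i by simp
      show "p u (Suc (i - 1)) \<in> p u' ` {1..L u'}" using i eq by auto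
      fix x y assume "x \<in> p u' ` {1..L u'}" "(x, y) \<in> R" and yv: "y \<noteq> v"
      then obtain j where j: "1 \<le> j" "j \<le> L u'" "(p u' j, y) \<in> R" by auto
      then have "y = p u' (j - 1) \<or> j < L u' \<and> y = p u' (Suc j)"
        using p_nbrs[OF u(2) j(1,2)] by (auto split: if_splits)
      moreover have "j - 1 \<noteq> 0" if "y = p u' (j - 1)" using that yv p0[OF u(2)] by metis
      ultimately show "y \<in> p u' ` {1..L u'}" using j(2) by force
    qed
    then obtain j where j: "1 \<le> j" "j \<le> L u'" "u = p u' j" by auto
    have "(u, v) \<in> R" using u(1) symR by (auto simp: N_def)
    then have "v = p u' (j - 1) \<or> j < L u' \<and> v = p u' (Suc j)"
      using p_nbrs[OF u(2) j(1,2)] j(3) by (auto split: if_splits)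
    then have "j = 1"
      using p_ne[OF u(2), of "j - 1"] p_ne[OF u(2), of "Suc j"] j(1,2) by fastforce
    then show "u = u'" using j(3) p1[OF u(2)] by simp
  qed
  obtain xs where xs: "set xs = N" "distinct xs"
    using finite_distinct_list[OF finN] by blast
  \<comment> \<open>Sorting makes the list of lengths canonical, so that equal multisets of lengths
    will give equal lists.\<close>
  define us where "us = sort_key L xs"
  have us: "set us = N" "distinct us" using xs by (auto simp: us_def)
  define m where "m = Suc n"
  define ls where "ls = map L us"
  have ls_len: "length ls = length us" by (simp add: ls_def)
  have ls_nth: "ls ! k = L (us ! k)" if "k < length us" for k using that by (simp add: ls_def)
  have us_nth: "us ! k \<in> N" if "k < length us" for k using that us(1) nth_mem by blast
  define f where "f x = (if fst x = 0 then c (snd x) else p (us ! (fst x - 1)) (snd x))" for x :: "nat \<times> nat"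
  have f0: "f (0, i) = c i" for i by (simp add: f_def)
  have fS: "f (Suc k, i) = p (us ! k) i" for k i by (simp add: f_def)
  have cases: "P x" if "x \<in> std_verts m ls" "P (0, 0)" "\<And>i. 1 \<le> i \<Longrightarrow> i \<le> n \<Longrightarrow> P (0, i)"
    "\<And>k i. k < length us \<Longrightarrow> 1 \<le> i \<Longrightarrow> i \<le> L (us ! k) \<Longrightarrow> P (Suc k, i)" for P x
  proof -
    obtain a i where x: "x = (a, i)" by fastforce
    show ?thesis
    proof (cases a)
      case 0
      then show ?thesis using that x by (cases "i = 0") (auto simp: std_verts_iff m_def)
    next
      case (Suc k)
      then have "k < length us" "1 \<le> i" "i \<le> L (us ! k)"
        using that(1) x by (auto simp: std_verts_iff ls_len ls_nth)
      then show ?thesis using that(4) x Suc by simp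
    qed
  qed
  have m1: "m - Suc 0 = n" by (simp add: m_def)
  have verts0: "(0, i) \<in> std_verts m ls \<longleftrightarrow> i \<le> n" for i
    by (auto simp: std_verts_iff m_def)
  have vertsS: "(Suc k, i) \<in> std_verts m ls \<longleftrightarrow> k < length us \<and> 1 \<le> i \<and> i \<le> L (us ! k)" for k i
    by (auto simp: std_verts_iff ls_len ls_nth)
  \<comment> \<open>Matching whole neighborhoods serves twice: the image of \<open>f\<close> is
    closed under adjacency, hence everything by connectivity, and together with injectivity it gives
    adjacency in both directions.\<close>
  have nbr: "R `` {f x} = f ` (std_arcs m ls `` {x})" if "x \<in> std_verts m ls" for x
    using that
  proof (rule cases)
    have "std_arcs m ls `` {(0, 0)} = {(0, 1), (0, n)} \<union> (\<lambda>k. (Suc k, 1)) ` {..<length us}"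
    proof (intro set_eqI)
      fix y :: "nat \<times> nat"
      obtain b j where y: "y = (b, j)" by fastforce
      show "y \<in> std_arcs m ls `` {(0, 0)} \<longleftrightarrow> y \<in> {(0, 1), (0, n)} \<union> (\<lambda>k. (Suc k, 1)) ` {..<length us}"
        using n L_pos[OF us_nth] unfolding y
        by (cases b) (auto simp: std_arcs_iff verts0 vertsS m1 image_iff)
    qed
    then have "f ` (std_arcs m ls `` {(0, 0)}) = {c 1, c n} \<union> (\<lambda>k. p (us ! k) 1) ` {..<length us}"
      by (simp add: image_Un image_image f0 fS)
    also have "(\<lambda>k. p (us ! k) 1) ` {..<length us} = N"
      using us_nth p1 us(1) by (auto simp: in_set_conv_nth image_iff)
    also have "{c 1, c n} \<union> N = R `` {v}"
    proof (intro equalityI subsetI)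
      fix y assume "y \<in> {c 1, c n} \<union> N"
      then show "y \<in> R `` {v}"
        using c_adj[of 0] c_last c_hub n symR by (auto simp: N_def)
    next
      fix y assume y: "y \<in> R `` {v}"
      show "y \<in> {c 1, c n} \<union> N"
      proof (cases "y \<in> c ` {..n}")
        case True
        then obtain i where i: "i \<le> n" "y = c i" by auto
        have i1: "1 \<le> i" using i y irr c_hub by (cases i) auto
        have "(c i, v) \<in> R" using y i symR by auto
        then have "c 0 = c (i - 1) \<or> c 0 = c (if i = n then 0 else Suc i)"
          using c_nbrs[OF i1 i(1)] c_hub by blast
        then have "i = 1 \<or> i = n"
        proof -
          have "c (i - 1) \<noteq> v" if "i \<noteq> 1" using c_ne[of "i - 1"] that i i1 by simp
          moreover have "c (Suc i) \<noteq> v" if "i \<noteq> n" using c_ne[of "Suc i"] that i by simp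
          ultimately show ?thesis
            using \<open>c 0 = c (i - 1) \<or> c 0 = c (if i = n then 0 else Suc i)\<close> c_hub by metis
        qed
        then show ?thesis using i by auto
      qed (use y in \<open>auto simp: N_def\<close>)
    qed
    finally show "R `` {f (0, 0)} = f ` (std_arcs m ls `` {(0, 0)})"
      by (simp add: f0 c_hub)
  next
    fix i assume i: "1 \<le> i" "i \<le> n"
    have "std_arcs m ls `` {(0, i)} = {(0, i - 1), (0, if i = n then 0 else Suc i)}"
    proof (intro set_eqI)
      fix y :: "nat \<times> nat"
      obtain b j where y: "y = (b, j)" by fastforce
      show "y \<in> std_arcs m ls `` {(0, i)} \<longleftrightarrow> y \<in> {(0, i - 1), (0, if i = n then 0 else Suc i)}"
        using i n unfolding y by (cases b) (auto simp: std_arcs_iff verts0 vertsS m1)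
    qed
    then show "R `` {f (0, i)} = f ` (std_arcs m ls `` {(0, i)})"
      using c_nbrs[OF i] by (simp add: f0)
  next
    fix k i assume ki: "k < length us" "1 \<le> i" "i \<le> L (us ! k)"
    have "std_arcs m ls `` {(Suc k, i)} =
        {if i = 1 then (0, 0) else (Suc k, i - 1)} \<union> (if i < L (us ! k) then {(Suc k, Suc i)} else {})"
    proof (intro set_eqI)
      fix y :: "nat \<times> nat"
      obtain b j where y: "y = (b, j)" by fastforce
      show "y \<in> std_arcs m ls `` {(Suc k, i)} \<longleftrightarrow>
        y \<in> {if i = 1 then (0, 0) else (Suc k, i - 1)} \<union> (if i < L (us ! k) then {(Suc k, Suc i)} else {})"
        using ki unfolding y by (cases b) (auto simp: std_arcs_iff verts0 vertsS)
    qed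
    then show "R `` {f (Suc k, i)} = f ` (std_arcs m ls `` {(Suc k, i)})"
      using p_nbrs[OF us_nth[OF ki(1)] ki(2,3)] p0[OF us_nth[OF ki(1)]]
      by (auto simp: f0 fS c_hub)
  qed
  have inj: "inj_on f (std_verts m ls)"
  proof (rule inj_onI)
    fix x y assume x: "x \<in> std_verts m ls" and y: "y \<in> std_verts m ls" and eq: "f x = f y"
    obtain a i where xa: "x = (a, i)" by fastforce
    obtain b j where yb: "y = (b, j)" by fastforce
    show "x = y"
    proof (cases a; cases b)
      assume "a = 0" "b = 0"
      then show ?thesis
        using x y eq xa yb inj_on_eq_iff[OF c_inj] by (auto simp: verts0 f0)
    next
      fix k assume "a = 0" "b = Suc k"
      then have "k < length us" "1 \<le> j" "j \<le> L (us ! k)" "i \<le> n" "c i = p (us ! k) j"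
        using x y eq xa yb by (auto simp: verts0 vertsS f0 fS)
      then show ?thesis
        using p_off_cycle[OF us_nth, of k j] by (metis atMost_iff imageI)
    next
      fix k assume "a = Suc k" "b = 0"
      then have "k < length us" "1 \<le> i" "i \<le> L (us ! k)" "j \<le> n" "c j = p (us ! k) i"
        using x y eq xa yb by (auto simp: verts0 vertsS f0 fS)
      then show ?thesis
        using p_off_cycle[OF us_nth, of k i] by (metis atMost_iff imageI)
    next
      fix k k' assume "a = Suc k" "b = Suc k'"
      then have *: "k < length us" "1 \<le> i" "i \<le> L (us ! k)" "k' < length us" "1 \<le> j" "j \<le> L (us ! k')"
        "p (us ! k) i = p (us ! k') j"
        using x y eq xa yb by (auto simp: vertsS fS)
      then have same: "us ! k = us ! k'"
        using p_disj[OF us_nth us_nth] by blast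
      then have "k = k'"
        using * us(2) nth_eq_iff_index_eq by blast
      moreover have "i = j"
        using * same inj_on_eq_iff[OF p_inj[OF us_nth[OF *(1)]], of i j] by simp
      ultimately show ?thesis
        using xa yb \<open>a = Suc k\<close> \<open>b = Suc k'\<close> by simp
    qed
  qed
  have arcs_sub: "std_arcs m ls `` {x} \<subseteq> std_verts m ls" for x
    by (auto simp: std_arcs_def)
  have img: "f ` std_verts m ls = V"
  proof (rule conn)
    show "f ` std_verts m ls \<noteq> {}"
      using verts0[of 0] by auto
    show "y \<in> f ` std_verts m ls" if "x \<in> f ` std_verts m ls" "(x, y) \<in> R" for x y
      using that nbr arcs_sub by blast
    show "f ` std_verts m ls \<subseteq> V"
    proof (intro image_subsetI)
      fix x assume "x \<in> std_verts m ls"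
      then show "f x \<in> V"
      proof (rule cases)
        show "f (0, 0) \<in> V" by (simp add: f0 c_hub hub)
        show "f (0, i) \<in> V" if "i \<le> n" for i
          using cycle_subset[OF c] that by (auto simp: f0)
        show "f (Suc k, i) \<in> V" if "k < length us" "1 \<le> i" "i \<le> L (us ! k)" for k i
          using p_nbrs[OF us_nth[OF that(1)] that(2,3)] RV by (auto simp: fS)
      qed
    qed
  qed
  have adj: "(x, y) \<in> std_arcs m ls \<longleftrightarrow> (f x, f y) \<in> R"
    if x: "x \<in> std_verts m ls" and y: "y \<in> std_verts m ls" for x y
  proof
    assume "(x, y) \<in> std_arcs m ls"
    then show "(f x, f y) \<in> R" using nbr[OF x] by blast
  next
    assume "(f x, f y) \<in> R"
    then have "f y \<in> f ` (std_arcs m ls `` {x})" using nbr[OF x] by blast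
    then obtain y' where "(x, y') \<in> std_arcs m ls" "f y' = f y" by force
    moreover have "y' = y"
      using inj_onD[OF inj \<open>f y' = f y\<close> _ y] \<open>(x, y') \<in> std_arcs m ls\<close> arcs_sub by blast
    ultimately show "(x, y) \<in> std_arcs m ls" by simp
  qed
  have "squid_model m ls"
  proof
    show "3 \<le> m" using n by (simp add: m_def)
    show "1 \<le> l" if "l \<in> set ls" for l
      using that L_pos us(1) by (auto simp: ls_def)
  qed
  moreover have "sorted ls" by (simp add: ls_def us_def)
  moreover have "bij_betw f (std_verts m ls) V" using inj img by (simp add: bij_betw_def)
  ultimately show ?thesis using adj by blast
qed

end

section \<open>From walks in a digraph to coordinates\<close>

lemma pcas_iff: "pcas u p w \<longleftrightarrow> map fst p @ [w] = u # map snd p"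
  by (induction p arbitrary: u) auto

lemma pawalk_verts_eq: "pcas u p w \<Longrightarrow> pawalk_verts u p = u # map snd p"
  by (induction p arbitrary: u) auto

lemma cycle_with_proj_iff:
  "pre_digraph.cycle (with_proj G) p \<longleftrightarrow> (\<exists>u\<in>pverts G. set p \<subseteq> parcs G \<and>
     map fst p @ [u] = u # map snd p \<and> distinct (map snd p) \<and> p \<noteq> [])"
  by (auto simp: pre_digraph.cycle_def pre_digraph.awalk_def cas_with_proj_eq
      awalk_verts_with_proj_eq pcas_iff[symmetric] pawalk_verts_eq)

lemma ugraph_cycle_imp_cycle_on:
  assumes "C \<in> ugraph_cycles G"
  shows "\<exists>c n. cycle_on (parcs G) c n"
proof -
  obtain p where p: "pre_digraph.cycle (with_proj G) p" "3 \<le> length p"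
    using assms by (auto simp: ugraph_cycles_def)
  then obtain u where sub: "set p \<subseteq> parcs G" and walk: "map fst p @ [u] = u # map snd p"
    and dist: "distinct (map snd p)"
    by (auto simp: cycle_with_proj_iff)
  \<comment> \<open>Vertices are indexed by the heads of the arcs, since these are what
    \<open>cycle_with_proj_iff\<close> gives as distinct. The start of the walk is then
    \<open>c n\<close>.\<close>
  define c where "c i = snd (p ! i)" for i
  define n where "n = length p - 1"
  have n: "2 \<le> n" "length p = Suc n"
    using p(2) by (auto simp: n_def)
  have arc: "p ! i \<in> parcs G" if "i \<le> n" for i
    using sub that n(2) by auto
  have step: "fst (p ! Suc i) = c i" if "i < n" for i
    using arg_cong[OF walk, of "\<lambda>xs. xs ! Suc i"] that n(2) by (simp add: nth_append c_def)
  have "u = c n"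
    using arg_cong[OF walk, of "\<lambda>xs. xs ! Suc n"] n(2) by (simp add: nth_append c_def)
  then have start: "fst (p ! 0) = c n"
    using arg_cong[OF walk, of "\<lambda>xs. xs ! 0"] n(2) by (simp add: nth_append)
  have "inj_on c {..n}"
    using dist n(2) by (auto simp: inj_on_def c_def distinct_conv_nth less_Suc_eq_le)
  moreover have "(c i, c (Suc i)) \<in> parcs G" if "i < n" for i
    using arc[of "Suc i"] step[OF that] that by (cases "p ! Suc i") (simp add: c_def)
  moreover have "(c n, c 0) \<in> parcs G"
    using arc[of 0] start by (cases "p ! 0") (simp add: c_def)
  ultimately show ?thesis
    using n(1) by (auto simp: cycle_on_def)
qed

text \<open>The vertex set is recovered as the union of the edges; in this way the uniqueness of the
  edge set yields the uniqueness of the vertex set.\<close>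

lemma cycle_on_imp_ugraph_cycle:
  assumes c: "cycle_on (parcs G) c n" and wf: "parcs G \<subseteq> pverts G \<times> pverts G"
  shows "\<exists>C\<in>ugraph_cycles G. \<Union> C = c ` {..n}"
proof -
  \<comment> \<open>The arc that enters \<open>c i\<close>; the walk thus starts and ends at
    \<open>c n\<close>.\<close>
  define e where "e i = (c (if i = 0 then n else i - 1), c i)" for i
  define p where "p = map e [0..<Suc n]"
  have n: "2 \<le> n" and inj: "inj_on c {..n}" and adj: "\<And>i. i < n \<Longrightarrow> (c i, c (Suc i)) \<in> parcs G"
    and last: "(c n, c 0) \<in> parcs G"
    using c by (auto simp: cycle_on_def)
  have len: "length p = Suc n"
    by (simp add: p_def)
  have nth: "p ! i = e i" if "i \<le> n" for i
    using that unfolding p_def by (subst nth_map) (simp_all del: upt_Suc)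
  have set: "set p = e ` {..n}"
    by (simp add: p_def atLeast0LessThan lessThan_Suc_atMost del: upt_Suc)
  have "e i \<in> parcs G" if "i \<le> n" for i
    using that last adj[of "i - 1"] by (auto simp: e_def)
  then have sub: "set p \<subseteq> parcs G"
    using set by auto
  have walk: "map fst p @ [c n] = c n # map snd p"
  proof (rule nth_equalityI)
    fix i assume "i < length (map fst p @ [c n])"
    then show "(map fst p @ [c n]) ! i = (c n # map snd p) ! i"
      using le_antisym
      by (cases i) (fastforce simp: nth_append len nth e_def less_Suc_eq_le not_less_eq_eq)+
  qed simp
  have "distinct (map snd p)"
    using inj by (auto simp: distinct_conv_nth len nth e_def less_Suc_eq_le inj_on_eq_iff)
  then have "pre_digraph.cycle (with_proj G) p"
    using sub walk last wf len by (auto simp: cycle_with_proj_iff intro!: bexI[of _ "c n"])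
  then have "(\<lambda>(u, v). {u, v}) ` set p \<in> ugraph_cycles G"
    using len n unfolding ugraph_cycles_def by (intro CollectI exI[of _ p]) simp
  moreover have "\<Union> ((\<lambda>(u, v). {u, v}) ` set p) = (\<Union>i\<le>n. {c (if i = 0 then n else i - 1), c i})"
    by (simp add: set e_def image_image)
  moreover have "\<dots> = c ` {..n}"
    by auto
  ultimately show ?thesis by metis
qed

text \<open>The arcs of a pair graph are already symmetric, so reachability in the symmetric closure
  is a chain of arcs of \<open>G\<close>, along which membership in \<open>S\<close>
  persists.\<close>

lemma connected_closed_eq:
  assumes G: "pair_graph G" and conn: "Digraph_Component.connected (with_proj G)"
    and S: "S \<subseteq> pverts G" "S \<noteq> {}" and closed: "\<And>x y. x \<in> S \<Longrightarrow> (x, y) \<in> parcs G \<Longrightarrow> y \<in> S"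
  shows "S = pverts G"
proof (intro equalityI subsetI S(1)[THEN subsetD])
  have arcs: "parcs (mk_symmetric (with_proj G)) = parcs G"
    using pair_graphD(3)[OF G] by (auto simp: parcs_mk_symmetric dest: symD)
  fix y assume y: "y \<in> pverts G"
  obtain x where x: "x \<in> S" using S(2) by blast
  have "x \<rightarrow>\<^sup>*\<^bsub>with_proj (mk_symmetric (with_proj G))\<^esub> y"
    using conn x y S(1) by (auto simp: Digraph_Component.connected_def strongly_connected_def)
  then have "(x, y) \<in> rtrancl_on (pverts G) (parcs G)"
    by (simp add: reachable_def arcs)
  then show "y \<in> S"
    by (induction rule: rtrancl_on_induct) (use x closed in auto)
qed

lemma squid_coordinates:
  assumes "squid G"
  shows "\<exists>m ls f. squid_model m ls \<and> sorted ls \<and> bij_betw f (std_verts m ls) (pverts G) \<and>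
    (\<forall>x\<in>std_verts m ls. \<forall>y\<in>std_verts m ls. (x, y) \<in> std_arcs m ls \<longleftrightarrow> (f x, f y) \<in> parcs G)"
proof -
  have G: "pair_graph G" and ex1: "\<exists>!C. C \<in> ugraph_cycles G"
    and conn: "Digraph_Component.connected (with_proj G)"
    and hub: "\<exists>!v. v \<in> pverts G \<and> out_degree (with_proj G) v > 2"
    using assms by (auto simp: squid_def unicyclic_def)
  obtain v where v: "v \<in> pverts G"
    and deg: "\<And>x. x \<in> pverts G \<Longrightarrow> x \<noteq> v \<Longrightarrow> out_degree (with_proj G) x \<le> 2"
    using hub by (metis not_less)
  have out_degree: "out_degree (with_proj G) x = card (parcs G `` {x})" for x
  proof -
    have "out_arcs (with_proj G) x = Pair x ` (parcs G `` {x})"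
      by (auto simp: out_arcs_def)
    then show ?thesis
      by (simp add: out_degree_def card_image inj_on_def)
  qed
  interpret hub_graph "pverts G" "parcs G" v
  proof
    fix c n c' n' assume "cycle_on (parcs G) c n" "cycle_on (parcs G) c' n'"
    then obtain C C' where "C \<in> ugraph_cycles G" "\<Union> C = c ` {..n}" "C' \<in> ugraph_cycles G" "\<Union> C' = c' ` {..n'}"
      using cycle_on_imp_ugraph_cycle pair_graphD(2)[OF G] by metis
    then show "c ` {..n} = c' ` {..n'}"
      using ex1 by metis
  next
    show "\<exists>c n. cycle_on (parcs G) c n"
      using ex1 ugraph_cycle_imp_cycle_on by blast
  next
    fix S assume "S \<subseteq> pverts G" "S \<noteq> {}" "\<And>x y. x \<in> S \<Longrightarrow> (x, y) \<in> parcs G \<Longrightarrow> y \<in> S"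
    then show "S = pverts G"
      by (rule connected_closed_eq[OF G conn])
  next
    fix x assume "x \<in> pverts G" "x \<noteq> v"
    then show "card (parcs G `` {x}) \<le> 2"
      using deg by (simp add: out_degree)
  qed (use pair_graphD[OF G] v in auto)
  show ?thesis by (rule ex_std_coordinates)
qed

section \<open>Isomorphism invariance and conclusion\<close>

lemma proper_colorings_pullback:
  assumes f: "bij_betw f (pverts G) (pverts H)"
    and wf: "parcs G \<subseteq> pverts G \<times> pverts G"
    and adj: "\<And>x y. x \<in> pverts G \<Longrightarrow> y \<in> pverts G \<Longrightarrow> (x, y) \<in> parcs G \<longleftrightarrow> (f x, f y) \<in> parcs H"
    and \<kappa>: "\<kappa> \<in> proper_colorings H"
  shows "restrict (\<kappa> \<circ> f) (pverts G) \<in> proper_colorings G"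
    "coloring_monomial G (restrict (\<kappa> \<circ> f) (pverts G)) = coloring_monomial H \<kappa>"
proof -
  have fV: "f x \<in> pverts H" if "x \<in> pverts G" for x
    using f that by (auto simp: bij_betw_def)
  have "\<kappa> (f x) \<noteq> \<kappa> (f y)" "x \<in> pverts G" "y \<in> pverts G" if "(x, y) \<in> parcs G" for x y
  proof -
    show xy: "x \<in> pverts G" "y \<in> pverts G"
      using that wf by auto
    have "(f x, f y) \<in> parcs H"
      using that adj[OF xy] by simp
    then show "\<kappa> (f x) \<noteq> \<kappa> (f y)"
      using \<kappa> by (auto simp: proper_colorings_def)
  qed
  moreover have "1 \<le> \<kappa> (f x)" if "x \<in> pverts G" for x
    using \<kappa> fV[OF that] by (auto simp: proper_colorings_def)
  ultimately show "restrict (\<kappa> \<circ> f) (pverts G) \<in> proper_colorings G"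
    by (auto simp: proper_colorings_def)
  show "coloring_monomial G (restrict (\<kappa> \<circ> f) (pverts G)) = coloring_monomial H \<kappa>"
    using sum.reindex_bij_betw[OF f, of "\<lambda>x. Poly_Mapping.single (\<kappa> x) (1::nat)"]
    by (simp add: coloring_monomial_def)
qed

text \<open>Pulling colorings back along \<open>f\<close> is injective and preserves monomials.
  Applied to \<open>f\<close> and to its inverse, this gives equality.\<close>

lemma chromatic_symmetric_function_le:
  assumes G: "pair_graph G" and H: "pair_graph H" and f: "bij_betw f (pverts G) (pverts H)"
    and adj: "\<And>x y. x \<in> pverts G \<Longrightarrow> y \<in> pverts G \<Longrightarrow> (x, y) \<in> parcs G \<longleftrightarrow> (f x, f y) \<in> parcs H"
  shows "chromatic_symmetric_function H m \<le> chromatic_symmetric_function G m"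
proof -
  let ?r = "\<lambda>\<kappa>. restrict (\<kappa> \<circ> f) (pverts G)"
  have "inj_on ?r {\<kappa> \<in> proper_colorings H. coloring_monomial H \<kappa> = m}"
  proof (rule inj_onI)
    fix \<kappa> \<mu> assume \<kappa>: "\<kappa> \<in> {\<kappa> \<in> proper_colorings H. coloring_monomial H \<kappa> = m}"
      and \<mu>: "\<mu> \<in> {\<kappa> \<in> proper_colorings H. coloring_monomial H \<kappa> = m}" and eq: "?r \<kappa> = ?r \<mu>"
    show "\<kappa> = \<mu>"
    proof (rule PiE_ext)
      show "\<kappa> \<in> pverts H \<rightarrow>\<^sub>E {1..}" "\<mu> \<in> pverts H \<rightarrow>\<^sub>E {1..}"
        using \<kappa> \<mu> by (auto simp: proper_colorings_def)
      fix y assume "y \<in> pverts H"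
      then obtain x where "x \<in> pverts G" "y = f x"
        using f by (auto simp: bij_betw_def)
      then show "\<kappa> y = \<mu> y"
        using fun_cong[OF eq, of x] by simp
    qed
  qed
  then have "card {\<kappa> \<in> proper_colorings H. coloring_monomial H \<kappa> = m} \<le>
      card {\<kappa> \<in> proper_colorings G. coloring_monomial G \<kappa> = m}"
    using proper_colorings_pullback[OF f pair_graphD(2)[OF G] adj] finite_proper_colorings_monomial[OF G]
    by (intro card_inj_on_le) auto
  then show ?thesis
    by (simp add: chromatic_symmetric_function_def)
qed

lemma chromatic_symmetric_function_iso:
  assumes G: "pair_graph G" and H: "pair_graph H" and f: "bij_betw f (pverts G) (pverts H)"
    and adj: "\<And>x y. x \<in> pverts G \<Longrightarrow> y \<in> pverts G \<Longrightarrow> (x, y) \<in> parcs G \<longleftrightarrow> (f x, f y) \<in> parcs H"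
  shows "chromatic_symmetric_function G = chromatic_symmetric_function H"
proof (rule ext, rule antisym)
  fix m
  show "chromatic_symmetric_function H m \<le> chromatic_symmetric_function G m"
    using assms by (rule chromatic_symmetric_function_le)
  let ?g = "inv_into (pverts G) f"
  show "chromatic_symmetric_function G m \<le> chromatic_symmetric_function H m"
  proof (rule chromatic_symmetric_function_le[OF H G bij_betw_inv_into[OF f]])
    fix x y assume "x \<in> pverts H" "y \<in> pverts H"
    then have "f (?g x) = x" "f (?g y) = y" "?g x \<in> pverts G" "?g y \<in> pverts G"
      using f by (auto simp: bij_betw_def f_inv_into_f inv_into_into)
    then show "(x, y) \<in> parcs H \<longleftrightarrow> (?g x, ?g y) \<in> parcs G"
      using adj by metis
  qed
qed

theorem theorem5p1:
  fixes G :: "'a pair_pre_digraph" and H :: "'b pair_pre_digraph"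
  assumes "squid G" and "squid H"
    and "\<not> digraph_iso (with_proj G) (with_proj H)"
  shows "chromatic_symmetric_function G \<noteq> chromatic_symmetric_function H"
proof
  assume same: "chromatic_symmetric_function G = chromatic_symmetric_function H"
  have G: "pair_graph G" and H: "pair_graph H"
    using assms by (auto simp: squid_def unicyclic_def)
  obtain m ls f where S: "squid_model m ls" "sorted ls" and f: "bij_betw f (std_verts m ls) (pverts G)"
    and fadj: "\<And>x y. x \<in> std_verts m ls \<Longrightarrow> y \<in> std_verts m ls \<Longrightarrow>
      (x, y) \<in> std_arcs m ls \<longleftrightarrow> (f x, f y) \<in> parcs G"
    using squid_coordinates[OF assms(1)] by blast
  obtain m' ls' g where S': "squid_model m' ls'" "sorted ls'" and g: "bij_betw g (std_verts m' ls') (pverts H)"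
    and gadj: "\<And>x y. x \<in> std_verts m' ls' \<Longrightarrow> y \<in> std_verts m' ls' \<Longrightarrow>
      (x, y) \<in> std_arcs m' ls' \<longleftrightarrow> (g x, g y) \<in> parcs H"
    using squid_coordinates[OF assms(2)] by blast
  have std: "pair_graph (std_squid m ls)" "pair_graph (std_squid m' ls')"
    using S(1) S'(1) by (auto simp: squid_model_def intro!: pair_graph_std_squid)
  have "chromatic_symmetric_function (std_squid m ls) = chromatic_symmetric_function G"
    by (rule chromatic_symmetric_function_iso[OF std(1) G, of f]) (use f fadj in \<open>auto simp: std_squid_def\<close>)
  moreover have "chromatic_symmetric_function (std_squid m' ls') = chromatic_symmetric_function H"
    by (rule chromatic_symmetric_function_iso[OF std(2) H, of g]) (use g gadj in \<open>auto simp: std_squid_def\<close>)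
  ultimately have "m = m'" "mset ls = mset ls'"
    using same std_squid_determined[OF S(1) S'(1)] by simp_all
  moreover have "ls = ls'"
    using S(2) S'(2) \<open>mset ls = mset ls'\<close> by (metis properties_for_sort)
  ultimately have eq: "m' = m" "ls' = ls"
    by simp_all
  \<comment> \<open>From \<open>G\<close> back to the common model, then on to
    \<open>H\<close>.\<close>
  let ?h = "g \<circ> inv_into (std_verts m ls) f"
  have inv: "bij_betw (inv_into (std_verts m ls) f) (pverts G) (std_verts m ls)"
    using f by (rule bij_betw_inv_into)
  have "bij_betw ?h (pverts G) (pverts H)"
    using inv g unfolding eq by (rule bij_betw_trans)
  moreover have "(u, w) \<in> parcs G \<longleftrightarrow> (?h u, ?h w) \<in> parcs H" if "u \<in> pverts G" "w \<in> pverts G" for u w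
  proof -
    let ?i = "inv_into (std_verts m ls) f"
    have i: "f (?i u) = u" "f (?i w) = w"
      using f that by (auto simp: bij_betw_def f_inv_into_f)
    have iV: "?i u \<in> std_verts m ls" "?i w \<in> std_verts m ls"
      using inv that by (auto simp: bij_betw_def)
    show ?thesis
      using fadj[OF iV] gadj[unfolded eq, OF iV] i by simp
  qed
  moreover have "pair_wf_digraph G" "pair_wf_digraph H"
    using G H by (auto simp: pair_graph_def pair_digraph_def pair_fin_digraph_def)
  ultimately have "digraph_iso (with_proj G) (with_proj H)"
    using digraph_iso_with_proj_iff by blast
  then show False
    using assms(3) by simp
qed

end
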